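(* Let $d\ge5$. Fix positive numbers $b,\gamma,\zeta$ and $\delta$ small, and let $y>0$. The following inequality holds for large $n$: $$\mathbb P_0\left(|\mathcal D_{b,b+\delta}|>n^\gamma y\right)\le\exp(-n^\zeta),\qquad\text{with}\quad \zeta<\left(1-\frac2d\right)\gamma+b-\delta,$$ provided either of the following is assumed: 1. (i) $\gamma+2b>1$ and $y>0$, or (ii) $\gamma+2b=1$ and $y>1+\sum_{x\in\mathbb Z^d}G_d(x)^2$; 2. $b>\frac2d\gamma$, in which case one can take $\zeta=\left(1-\frac2d\right)\gamma+b$.
   Context: $(S_k)_{k\ge0}$ is the nearest-neighbour symmetric random walk on $\mathbb Z^d$ with $S_0=0$, with law $\mathbb P_0$ and expectation $\mathbb E_0$. Local times: $l_n(x)=\sum_{k=0}^n\mathbf 1\{S_k=x\}$, $l_\infty(x)=\sum_{k\ge0}\mathbf 1\{S_k=x\}$. Green kernel: $G_d(x)=\mathbb E_0[l_\infty(x)]$. For $0<b<a$, $\mathcal D_{b,a}:=\{x\in\mathbb Z^d:\ n^b\le l_n(x)<n^a\}$, and $|\cdot|$ denotes cardinality.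
   Formalization: In case 2, "one can take ζ=(1-2/d)γ+b" is proved as the bound exp(-κ y^{1-2/d} n^{(1-2/d)γ+b}) with κ>0 depending only on d; the literal bound exp(-n^{(1-2/d)γ+b}) fails for small y when γ+b<1, by confining the walk to a box. *)

theory Defs
  imports "HOL-Probability.Probability"
begin

definition unit_steps :: "(int ^ 'd::finite) set" where
  "unit_steps = range (\<lambda>i. axis i 1) \<union> range (\<lambda>i. axis i (-1))"

text \<open>The law \<open>\<bbbP>\<^sub>0\<close> is realised on the canonical space of increment sequences.\<close>

definition rw_measure :: "(nat \<Rightarrow> int ^ 'd::finite) measure" where
  "rw_measure = (\<Pi>\<^sub>M i\<in>(UNIV :: nat set). measure_pmf (pmf_of_set unit_steps))"

definition walk :: "nat \<Rightarrow> (nat \<Rightarrow> int ^ 'd::finite) \<Rightarrow> int ^ 'd" where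
  "walk k \<omega> = (\<Sum>i<k. \<omega> i)"

definition local_time :: "nat \<Rightarrow> int ^ 'd::finite \<Rightarrow> (nat \<Rightarrow> int ^ 'd) \<Rightarrow> real" where
  "local_time n x \<omega> = (\<Sum>k\<le>n. indicator {x} (walk k \<omega>))"

text \<open>The total local time, the Green kernel and the sum of its squares take values in
  \<open>[0,\<infinity>]\<close>, so no integrability or summability is presupposed.\<close>

definition total_local_time :: "int ^ 'd::finite \<Rightarrow> (nat \<Rightarrow> int ^ 'd) \<Rightarrow> ennreal" where
  "total_local_time x \<omega> = (\<Sum>k. indicator {x} (walk k \<omega>))"

definition green :: "int ^ 'd::finite \<Rightarrow> ennreal" where
  "green x = (\<integral>\<^sup>+\<omega>. total_local_time x \<omega> \<partial>rw_measure)"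

definition level_set :: "nat \<Rightarrow> real \<Rightarrow> real \<Rightarrow> (nat \<Rightarrow> int ^ 'd::finite) \<Rightarrow> (int ^ 'd) set" where
  "level_set n b a \<omega> =
     {x. real n powr b \<le> local_time n x \<omega> \<and> local_time n x \<omega> < real n powr a}"

text \<open>For \<open>n \<ge> 1\<close> the level set consists of visited sites and is finite, so \<open>card\<close> is its
  cardinality.\<close>

definition level_prob :: "'d::finite itself \<Rightarrow> nat \<Rightarrow> real \<Rightarrow> real \<Rightarrow> real \<Rightarrow> real" where
  "level_prob _ n b a t =
     measure rw_measure {\<omega> \<in> space (rw_measure :: (nat \<Rightarrow> int ^ 'd) measure).
       real (card (level_set n b a \<omega>)) > t}"

end

theory Submission
  imports Defs
begin

text \<open>The heat kernel bound \<open>p\<^sub>k(x) \<le> C k\<^bsup>-d/2\<^esup>\<close> makes the expected number of visits to a set \<open>\<Lambda>\<close>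
  at most \<open>C |\<Lambda>|\<^bsup>2/d\<^esup>\<close> from every starting point, so Khas'minskii's lemma gives
  \<open>P(l\<^sub>n(\<Lambda>) \<ge> u) \<le> 2 exp (- u / (C |\<Lambda>|\<^bsup>2/d\<^esup>))\<close>. If \<open>b > 2 \<gamma> / d\<close>, the rate
  \<open>n\<^bsup>(1-2/d)\<gamma>+b\<^esup>\<close> obtained from \<open>u = n\<^bsup>b\<^esup> |\<Lambda>|\<close> beats the entropy \<open>n\<^bsup>\<gamma>\<^esup> log n\<close> of the choice of
  \<open>\<Lambda>\<close>, and a union bound suffices.

  Otherwise \<open>\<Lambda>\<close> has to be read off from the path itself. Cut the time interval into \<open>Q = n\<^bsup>\<epsilon>\<^esup>\<close>
  blocks. A site with at least \<open>t\<close> visits either has \<open>t / 2\<close> of them in one block or has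
  \<open>t / 4\<close> of them on both sides of some cut. In the second case the path before the cut fixes the
  random set of its sites of level \<open>t / 4\<close>, which the independent path after the cut has to
  visit often. The size of this set is controlled by an induction over decreasing set sizes, in steps
  of a factor \<open>Q\<close>. The first case leads back to the shorter time \<open>n / Q\<close>; as the blocks are
  independent and \<open>s \<mapsto> s\<^bsup>1-2/d\<^esup>\<close> is subadditive, only a constant is lost in the exponent, and the
  induction over time scales \<open>Q\<^bsup>k\<^esup>\<close> ends after about \<open>1 / \<epsilon>\<close> steps.\<close>

section \<open>Heat kernel\<close>

fun srw_prob :: "nat \<Rightarrow> int \<Rightarrow> real" where
  "srw_prob 0 j = of_bool (j = 0)"
| "srw_prob (Suc m) j = (srw_prob m (j + 1) + srw_prob m (j - 1)) / 2"

text \<open>Consecutive central binomial coefficients have ratio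
  \<open>2 * (2 * k + 1) / (k + 1)\<close>, so the induction step comes down to
  \<open>(2 * k + 1) * (2 * k + 3) \<le> 4 * (k + 1)\<^sup>2\<close>.\<close>

lemma central_binomial_squared_le: "(real (2 * k choose k))\<^sup>2 * (2 * real k + 1) \<le> 16 ^ k"
proof (induction k)
  case 0
  then show ?case by simp
next
  case (Suc k)
  define c where "c = real (2 * k choose k)"
  define c' where "c' = real (2 * Suc k choose Suc k)"
  have e1: "real (Suc k) * c' = real (2 * Suc k) * real (Suc (2 * k) choose k)"
    using Suc_times_binomial_eq[of "Suc (2*k)" k] unfolding c'_def
    by (metis (no_types, lifting) Suc_eq_plus1 ab_semigroup_mult_class.mult_ac(1) mult.commute mult_2 mult_Suc_right of_nat_mult add_Suc_right add_Suc)
  have "Suc k * (Suc (2 * k) choose k) = Suc k * (Suc (2 * k) choose Suc k)"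
    using binomial_symmetric[of k "Suc (2*k)"] by simp
  also have "\<dots> = Suc (2 * k) * (2 * k choose k)"
    using Suc_times_binomial_eq[of "2*k" k] by (metis mult.commute)
  finally have e2: "real (Suc k) * real (Suc (2 * k) choose k) = real (Suc (2 * k)) * c"
    unfolding c_def by (metis of_nat_mult)
  have e3: "(k + 1) * c' = 2 * (2 * k + 1) * c"
  proof -
    have "(real k + 1) * ((real k + 1) * c') = (real k + 1) * (2 * (2 * k + 1) * c)"
      using e1 e2 by (simp add: algebra_simps)
    then show ?thesis by (metis mult_cancel_left of_nat_Suc of_nat_neq_0 add.commute Suc_eq_plus1)
  qed
  have "(k + 1)\<^sup>2 * (c'\<^sup>2 * (2 * real k + 3)) = ((k + 1) * c')\<^sup>2 * (2 * real k + 3)"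
    by (simp add: power_mult_distrib)
  also have "\<dots> = (4 * (2 * real k + 1) * (2 * real k + 3)) * (c\<^sup>2 * (2 * real k + 1))"
    unfolding e3 by (simp add: power2_eq_square algebra_simps)
  also have "\<dots> \<le> 16 * (real k + 1)\<^sup>2 * (16 ^ k)"
    using Suc zero_le_mult_iff[of "c\<^sup>2" "2 * real k + 1"] unfolding c_def[symmetric]
    by (intro mult_mono[of _ "16 * (real k + 1)\<^sup>2"]) (auto simp: power2_eq_square algebra_simps)
  finally have "(real k + 1)\<^sup>2 * (c'\<^sup>2 * (2 * real k + 3)) \<le> (real k + 1)\<^sup>2 * (16 * 16 ^ k)"
    by (simp add: algebra_simps)
  then have "c'\<^sup>2 * (2 * real k + 3) \<le> 16 * 16 ^ k"
    by (rule mult_left_le_imp_le) simp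
  moreover have "2 * real k + 3 = 2 * real (Suc k) + 1" by simp
  ultimately show ?case
    unfolding c'_def power_Suc by (simp only:)
qed

text \<open>The central coefficient is the largest. For odd \<open>m = 2 * j + 1\<close> it is half
  of the next even central one, \<open>2 * Suc j choose Suc j\<close>.\<close>

lemma binomial_le_two_power_div_sqrt: "real (m choose k) \<le> 2 ^ m / sqrt (real m + 1)"
proof -
  have even: "real (2 * j choose j) \<le> 2 ^ (2 * j) / sqrt (2 * real j + 1)" for j
  proof -
    have "(real (2 * j choose j) * sqrt (2 * real j + 1))\<^sup>2 \<le> (2 ^ (2 * j))\<^sup>2"
      using central_binomial_squared_le[of j]
      by (simp add: power_mult_distrib flip: power_mult) (simp add: power_mult)
    then have "real (2 * j choose j) * sqrt (2 * real j + 1) \<le> 2 ^ (2 * j)"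
      by (rule power2_le_imp_le) simp
    then show ?thesis by (simp add: field_simps)
  qed
  have "real (m choose (m div 2)) \<le> 2 ^ m / sqrt (real m + 1)"
  proof (cases "even m")
    case True
    then show ?thesis using even[of "m div 2"] by (auto elim!: evenE)
  next
    case False
    then obtain j where m: "m = 2 * j + 1" by (auto elim: oddE)
    have "(2 * Suc j) choose Suc j = 2 * (Suc (2 * j) choose j)"
      using binomial_symmetric[of j "Suc (2*j)"] by simp
    then have "2 * real (m choose (m div 2)) = real (2 * Suc j choose Suc j)"
      by (simp add: m)
    also have "\<dots> \<le> 2 ^ (2 * Suc j) / sqrt (2 * real (Suc j) + 1)" by (rule even)
    also have "\<dots> \<le> 2 ^ (2 * Suc j) / sqrt (real m + 1)"
      by (intro divide_left_mono) (auto simp: m)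
    finally show ?thesis by (simp add: m field_simps)
  qed
  moreover have "real (m choose k) \<le> real (m choose (m div 2))"
    using binomial_maximum by simp
  ultimately show ?thesis by linarith
qed

text \<open>Reaching \<open>j\<close> takes \<open>(m + j) / 2\<close> steps up, which forces the
  parity and range condition; the induction step is Pascal's rule.\<close>

lemma srw_prob_binomial:
  "srw_prob m j = (if even (int m + j) \<and> \<bar>j\<bar> \<le> int m
     then real (m choose nat ((int m + j) div 2)) / 2 ^ m else 0)"
proof (induction m arbitrary: j)
  case 0
  then show ?case by auto
next
  case (Suc m)
  show ?case
  proof (cases "even (int (Suc m) + j) \<and> \<bar>j\<bar> \<le> int (Suc m)")
    case False
    then have "srw_prob m (j + 1) = 0 \<and> srw_prob m (j - 1) = 0"
      unfolding Suc by (auto simp: abs_if split: if_splits)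
    then show ?thesis unfolding srw_prob.simps if_not_P[OF False] by simp
  next
    case True
    then obtain r where r: "int (Suc m) + j = 2 * r" by blast
    then have r0: "0 \<le> r" "r \<le> int (Suc m)" and j: "j = 2 * r - int (Suc m)" using True by auto
    then obtain i where i: "r = int i" using nonneg_int_cases by blast
    have 1: "srw_prob m (j + 1) = real (m choose i) / 2 ^ m"
      unfolding Suc j i using r0 i by (auto simp: abs_if not_le binomial_eq_0 split: if_splits)
    have 2: "srw_prob m (j - 1) = (if i = 0 then 0 else real (m choose (i - 1)) / 2 ^ m)"
    proof -
      have e: "int m + (j - 1) = 2 * (int i - 1)" using j i by simp
      have "even (int m + (j - 1))" "(int m + (j - 1)) div 2 = int i - 1" unfolding e by simp_all
      moreover have "\<bar>j - 1\<bar> \<le> int m \<longleftrightarrow> i \<noteq> 0" using j i r0 by (auto simp: abs_if)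
      moreover have "nat (int i - 1) = i - 1" by simp
      ultimately show ?thesis unfolding Suc by (simp del: even_add even_diff)
    qed
    have "srw_prob (Suc m) j = real (Suc m choose i) / 2 ^ Suc m"
      using 1 2 by (cases i) (auto simp: field_simps)
    then show ?thesis using True r i by simp
  qed
qed

lemma srw_prob_nonneg: "0 \<le> srw_prob m j"
  unfolding srw_prob_binomial by auto

lemma srw_prob_le: "srw_prob m j \<le> 1 / sqrt (real m + 1)"
proof -
  have "real (m choose i) / 2 ^ m \<le> 1 / sqrt (real m + 1)" for i
    using binomial_le_two_power_div_sqrt[of m i] by (simp add: field_simps)
  then show ?thesis unfolding srw_prob_binomial by auto
qed

section \<open>Averages over the choice of coordinates\<close>

text \<open>Expectation of \<open>F N\<close>, where \<open>N\<close> counts how often each of the \<open>CARD('d)\<close> coordinates is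
  chosen in \<open>k\<close> uniform independent draws.\<close>

fun multinom :: "nat \<Rightarrow> (('d::finite \<Rightarrow> nat) \<Rightarrow> real) \<Rightarrow> real" where
  "multinom 0 F = F (\<lambda>_. 0)"
| "multinom (Suc k) F = (\<Sum>i\<in>UNIV. multinom k (\<lambda>N. F (N(i := Suc (N i))))) / real CARD('d)"

lemma multinom_add: "multinom k (\<lambda>N. F N + G N) = multinom k F + multinom k G"
  by (induction k arbitrary: F G) (auto simp: sum.distrib add_divide_distrib)

lemma multinom_cmult: "multinom k (\<lambda>N. c * F N) = c * multinom k F"
  by (induction k arbitrary: F) (auto simp: sum_distrib_left)

lemma multinom_const: "multinom k (\<lambda>N::'d::finite \<Rightarrow> nat. c) = c"
  by (induction k) auto

lemma multinom_mono: "(\<And>N. F N \<le> G N) \<Longrightarrow> multinom k F \<le> multinom k G"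
  by (induction k arbitrary: F G) (auto intro!: divide_right_mono sum_mono)

text \<open>Each of the \<open>k + 1\<close> draws picks \<open>i\<close> with probability
  \<open>1 / CARD('d)\<close>, and given that one of them does, the others are \<open>k\<close>
  uniform draws. The induction removes one draw \<open>j\<close>, which adds \<open>1\<close> to the
  count of \<open>i\<close> exactly if \<open>j = i\<close>.\<close>

lemma multinom_size_bias:
  fixes F :: "('d::finite \<Rightarrow> nat) \<Rightarrow> real"
  shows "multinom (Suc k) (\<lambda>N. real (N i) * F N) =
    real (Suc k) / real CARD('d) * multinom k (\<lambda>N. F (N(i := Suc (N i))))"
proof (induction k arbitrary: F)
  case 0
  have "(\<Sum>j\<in>UNIV. real (((\<lambda>_. 0)(j := Suc 0)) i) * F ((\<lambda>_. 0)(j := Suc 0)))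
     = (\<Sum>j\<in>UNIV. if j = i then F ((\<lambda>_. 0)(i := Suc 0)) else 0)"
    by (intro sum.cong) auto
  then show ?case by (simp add: fun_upd_def)
next
  case (Suc k)
  let ?d = "real CARD('d)"
  define up where "up j N = N(j := Suc (N j))" for j and N :: "'d \<Rightarrow> nat"
  have comm: "up i (up j N) = up j (up i N)" for j N
    by (auto simp: up_def fun_eq_iff)
  have "multinom (Suc (Suc k)) (\<lambda>N. real (N i) * F N)
      = (\<Sum>j\<in>UNIV. multinom (Suc k) (\<lambda>N. real (up j N i) * F (up j N))) / ?d"
    by (simp only: multinom.simps up_def)
  also have "(\<lambda>j N. real (up j N i) * F (up j N))
     = (\<lambda>j N. real (N i) * F (up j N) + (if j = i then 1 else 0) * F (up j N))"
    by (auto simp: up_def fun_eq_iff algebra_simps)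
  also have "(\<Sum>j\<in>UNIV. multinom (Suc k)
        (\<lambda>N. real (N i) * F (up j N) + (if j = i then 1 else 0) * F (up j N))) =
      (\<Sum>j\<in>UNIV. real (Suc k) / ?d * multinom k (\<lambda>N. F (up j (up i N)))) +
      (\<Sum>j\<in>UNIV. if j = i then multinom (Suc k) (\<lambda>N. F (up i N)) else 0)"
    unfolding multinom_add sum.distrib Suc up_def[symmetric]
    by (intro arg_cong2[where f="(+)"] sum.cong refl) (auto simp: multinom_const simp del: multinom.simps)
  also have "(\<Sum>j\<in>UNIV. real (Suc k) / ?d * multinom k (\<lambda>N. F (up j (up i N))))
      = real (Suc k) * multinom (Suc k) (\<lambda>N. F (up i N))"
    unfolding comm[symmetric] by (simp add: up_def sum_distrib_left sum_divide_distrib)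
  finally show ?case
    unfolding up_def[symmetric] by (simp add: field_simps del: multinom.simps)
qed

text \<open>Size biasing trades a factor \<open>1 / (N i + 1)\<close> at time \<open>k\<close> for a factor \<open>CARD('d) / (k + 1)\<close> and
  the event \<open>N i > 0\<close> at time \<open>k + 1\<close>, so the factors are removed one at a time.\<close>

lemma multinom_prod_inverse_le:
  fixes I :: "'d::finite set"
  shows "multinom k (\<lambda>N. \<Prod>i\<in>I. 1 / (real (N i) + 1)) \<le> (real CARD('d) / (real k + 1)) ^ card I"
proof -
  have "finite I" by simp
  then show ?thesis
  proof (induction I arbitrary: k)
    case empty
    then show ?case by (simp add: multinom_const)
  next
    case (insert i I)
    let ?d = "real CARD('d)"
    let ?f = "\<lambda>N::'d \<Rightarrow> nat. \<Prod>i\<in>I. 1 / (real (N i) + 1)"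
    have f: "?f (N(i := m)) = ?f N" for N m
      using insert by (intro prod.cong) auto
    have "multinom (Suc k) (\<lambda>N. real (N i) * (?f N / real (N i)))
        = real (Suc k) / ?d * multinom k (\<lambda>N. ?f (N(i := Suc (N i))) / real (Suc (N i)))"
      by (subst multinom_size_bias) simp
    then have eq: "multinom k (\<lambda>N. ?f N / real (Suc (N i)))
        = ?d / real (Suc k) * multinom (Suc k) (\<lambda>N. real (N i) * (?f N / real (N i)))"
      unfolding f by (simp add: field_simps del: multinom.simps)
    have "multinom k (\<lambda>N. \<Prod>i\<in>insert i I. 1 / (real (N i) + 1))
       = multinom k (\<lambda>N. ?f N / real (Suc (N i)))"
      using insert by (simp add: add.commute)
    also note eq
    finally have eq: "multinom k (\<lambda>N. \<Prod>i\<in>insert i I. 1 / (real (N i) + 1)) =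
      ?d / real (Suc k) * multinom (Suc k) (\<lambda>N. real (N i) * (?f N / real (N i)))" .
    \<comment> \<open>The integrand is \<open>?f N\<close> if \<open>N i > 0\<close> and
      \<open>0\<close> otherwise. The induction hypothesis is then applied at \<open>Suc k\<close>,
      hence the arbitrary \<open>k\<close>.\<close>
    have "multinom (Suc k) (\<lambda>N. real (N i) * (?f N / real (N i))) \<le> multinom (Suc k) ?f"
      by (intro multinom_mono) (auto intro: prod_nonneg)
    also have "\<dots> \<le> (?d / (real (Suc k) + 1)) ^ card I" by (rule insert)
    also have "\<dots> \<le> (?d / (real k + 1)) ^ card I"
      by (intro power_mono divide_left_mono) auto
    finally have "?d / real (Suc k) * multinom (Suc k) (\<lambda>N. real (N i) * (?f N / real (N i)))
        \<le> ?d / real (Suc k) * (?d / (real k + 1)) ^ card I"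
      by (intro mult_left_mono) simp_all
    then show ?case unfolding eq using insert by (simp add: add.commute)
  qed
qed

text \<open>Nonnegativity of the variance of \<open>F\<close>.\<close>

lemma multinom_square_le:
  fixes F :: "('d::finite \<Rightarrow> nat) \<Rightarrow> real"
  shows "(multinom k F)\<^sup>2 \<le> multinom k (\<lambda>N. (F N)\<^sup>2)"
proof -
  define a where "a = multinom k F"
  have "0 = multinom k (\<lambda>N::'d \<Rightarrow> nat. 0)" by (simp add: multinom_const)
  also have "\<dots> \<le> multinom k (\<lambda>N. (F N - a)\<^sup>2)" by (intro multinom_mono) simp
  also have "(\<lambda>N. (F N - a)\<^sup>2) = (\<lambda>N. (F N)\<^sup>2 + ((-2 * a) * F N + a\<^sup>2))"
    by (auto simp: power2_eq_square algebra_simps)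
  also have "multinom k \<dots> = multinom k (\<lambda>N. (F N)\<^sup>2) - a\<^sup>2"
    unfolding multinom_add multinom_cmult multinom_const a_def by (simp add: power2_eq_square)
  finally show ?thesis by (simp add: a_def)
qed

text \<open>The one-step transition operator of the walk:
  \<open>(step_mean ^^ k) (indicator {z}) x\<close> is the probability of being at \<open>z\<close>
  after \<open>k\<close> steps from \<open>x\<close>.\<close>

definition step_mean :: "(int ^ 'd::finite \<Rightarrow> real) \<Rightarrow> int ^ 'd \<Rightarrow> real" where
  "step_mean f x = (\<Sum>i\<in>UNIV. (f (x + axis i 1) + f (x + axis i (-1))) / 2) / real CARD('d)"

text \<open>A step chooses a coordinate and then a sign. Given the numbers \<open>N\<close> of
  choices, the coordinates are independent one-dimensional walks, hence the product; one step along
  \<open>i\<close> is the recursion of \<open>srw_prob\<close> in the factor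
  \<open>i\<close>.\<close>

lemma step_mean_iterate_eq_multinom:
  fixes z x :: "int ^ 'd::finite"
  shows "(step_mean ^^ k) (indicator {z}) x = multinom k (\<lambda>N. \<Prod>i\<in>UNIV. srw_prob (N i) (z $ i - x $ i))"
proof (induction k arbitrary: x)
  case 0
  show ?case by (auto simp: vec_eq_iff indicator_def) metis
next
  case (Suc k)
  have *: "(\<Prod>j\<in>UNIV. srw_prob ((N(i := Suc (N i))) j) (z $ j - x $ j)) =
     1/2 * (\<Prod>j\<in>UNIV. srw_prob (N j) (z $ j - (x + axis i 1) $ j)) +
     1/2 * (\<Prod>j\<in>UNIV. srw_prob (N j) (z $ j - (x + axis i (-1)) $ j))" for N i
  proof -
    have rem: "(\<Prod>j\<in>UNIV. g j) = g i * (\<Prod>j\<in>UNIV - {i}. g j)" for g :: "'d \<Rightarrow> real"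
      by (rule prod.remove) auto
    have a1: "(\<Prod>j\<in>UNIV - {i}. srw_prob ((N(i := Suc (N i))) j) (z $ j - x $ j)) = (\<Prod>j\<in>UNIV - {i}. srw_prob (N j) (z $ j - x $ j))"
      by (intro prod.cong) auto
    have a2: "(\<Prod>j\<in>UNIV - {i}. srw_prob (N j) (z $ j - (x + axis i c) $ j)) = (\<Prod>j\<in>UNIV - {i}. srw_prob (N j) (z $ j - x $ j))" for c
      by (intro prod.cong) (auto simp: axis_def)
    show ?thesis
      unfolding rem a1 a2 by (simp add: algebra_simps axis_def)
  qed
  have "(step_mean ^^ Suc k) (indicator {z}) x = step_mean ((step_mean ^^ k) (indicator {z})) x"
    by simp
  then show ?case
    unfolding multinom.simps * multinom_add multinom_cmult
    by (simp add: Suc step_mean_def[of "(step_mean ^^ k) (indicator {z})"] add_divide_distrib)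
qed

text \<open>The factors are at most \<open>1 / sqrt (real (N i) + 1)\<close>. Jensen's inequality
  passes to the square, where \<open>multinom_prod_inverse_le\<close> applies; the final square root
  halves the exponent.\<close>

lemma heat_kernel_bound:
  fixes z x :: "int ^ 'd::finite"
  shows "(step_mean ^^ k) (indicator {z}) x \<le> (real CARD('d) / (real k + 1)) powr (real CARD('d) / 2)"
proof -
  let ?d = "real CARD('d)"
  let ?F = "\<lambda>N::'d \<Rightarrow> nat. \<Prod>i\<in>UNIV. 1 / sqrt (real (N i) + 1)"
  have "(step_mean ^^ k) (indicator {z}) x \<le> multinom k ?F"
    unfolding step_mean_iterate_eq_multinom
    by (intro multinom_mono prod_mono) (auto simp: srw_prob_nonneg srw_prob_le)
  also have "multinom k ?F \<le> sqrt ((?d / (real k + 1)) ^ CARD('d))"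
  proof (rule real_le_rsqrt)
    have "(multinom k ?F)\<^sup>2 \<le> multinom k (\<lambda>N. (?F N)\<^sup>2)" by (rule multinom_square_le)
    also have "(\<lambda>N. (?F N)\<^sup>2) = (\<lambda>N. \<Prod>i\<in>UNIV. 1 / (real (N i) + 1))"
      by (simp add: prod_power_distrib power_divide)
    also have "multinom k \<dots> \<le> (?d / (real k + 1)) ^ CARD('d)" by (rule multinom_prod_inverse_le)
    finally show "(multinom k ?F)\<^sup>2 \<le> (?d / (real k + 1)) ^ CARD('d)" .
  qed
  also have "\<dots> = ((?d / (real k + 1)) powr ?d) powr (1/2)"
    by (simp add: powr_half_sqrt powr_realpow)
  also have "\<dots> = (?d / (real k + 1)) powr (?d / 2)" by (simp only: powr_powr) simp
  finally show ?thesis .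
qed

section \<open>Visits along lists of steps and Khas'minskii's lemma\<close>

lemma finite_set_replicate_pmf:
  assumes "finite (set_pmf p)"
  shows "finite (set_pmf (replicate_pmf n p))"
proof -
  have "set_pmf (replicate_pmf n p) = {xs. set xs \<subseteq> set_pmf p \<and> length xs = n}"
    by (auto simp: set_replicate_pmf in_lists_conv_set)
  then show ?thesis using finite_lists_length_eq[OF assms] by simp
qed

lemma expectation_mono_finite:
  assumes "finite (set_pmf p)" "\<And>x. x \<in> set_pmf p \<Longrightarrow> f x \<le> g x"
  shows "measure_pmf.expectation p f \<le> (measure_pmf.expectation p g :: real)"
  using assms by (intro integral_mono_AE integrable_measure_pmf_finite) (auto simp: AE_measure_pmf_iff)

lemma expectation_replicate_pmf_add:
  fixes f :: "'a list \<Rightarrow> real"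
  assumes "finite (set_pmf p)"
  shows "measure_pmf.expectation (replicate_pmf (m + n) p) f =
    measure_pmf.expectation (replicate_pmf m p)
      (\<lambda>xs. measure_pmf.expectation (replicate_pmf n p) (\<lambda>ys. f (xs @ ys)))"
proof -
  let ?S = "set_pmf (replicate_pmf m p)" and ?T = "set_pmf (replicate_pmf n p)"
  have fin: "finite ?S" "finite ?T" using assms by (simp_all add: finite_set_replicate_pmf)
  have "measure_pmf.expectation (replicate_pmf (m + n) p) f =
     (\<Sum>xs\<in>?S. pmf (replicate_pmf m p) xs *
       measure_pmf.expectation (map_pmf ((@) xs) (replicate_pmf n p)) f)"
    unfolding replicate_pmf_distrib using fin
    by (subst pmf_expectation_bind[of ?S]) (auto simp: map_pmf_def)
  also have "\<dots> = (\<Sum>xs\<in>?S. pmf (replicate_pmf m p) xs *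
       measure_pmf.expectation (replicate_pmf n p) (\<lambda>ys. f (xs @ ys)))"
    by simp
  also have "\<dots> = measure_pmf.expectation (replicate_pmf m p)
      (\<lambda>xs. measure_pmf.expectation (replicate_pmf n p) (\<lambda>ys. f (xs @ ys)))"
    using fin by (subst integral_measure_pmf[of ?S]) auto
  finally show ?thesis .
qed

lemma expectation_replicate_pmf_Suc:
  fixes f :: "'a list \<Rightarrow> real"
  assumes "finite (set_pmf p)"
  shows "measure_pmf.expectation (replicate_pmf (Suc n) p) f =
    measure_pmf.expectation p (\<lambda>x. measure_pmf.expectation (replicate_pmf n p) (\<lambda>xs. f (x # xs)))"
  using expectation_replicate_pmf_add[OF assms, of 1 n f] by (simp add: replicate_pmf_1[unfolded One_nat_def] del: replicate_pmf.simps)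

lemma prob_replicate_pmf_add:
  assumes "finite (set_pmf p)"
  shows "measure_pmf.prob (replicate_pmf (m + n) p) {xs. P xs} =
    measure_pmf.expectation (replicate_pmf m p)
      (\<lambda>xs. measure_pmf.prob (replicate_pmf n p) {ys. P (xs @ ys)})"
proof -
  have "measure_pmf.prob (replicate_pmf (m + n) p) {xs. P xs} =
      measure_pmf.expectation (replicate_pmf (m + n) p) (indicator {xs. P xs})" by simp
  also have "\<dots> = measure_pmf.expectation (replicate_pmf m p) (\<lambda>xs.
      measure_pmf.expectation (replicate_pmf n p) (\<lambda>ys. indicator {xs. P xs} (xs @ ys)))"
    by (rule expectation_replicate_pmf_add[OF assms])
  also have "(\<lambda>xs ys. indicator {xs. P xs} (xs @ ys) :: real) = (\<lambda>xs. indicator {ys. P (xs @ ys)})"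
    by (simp add: indicator_def fun_eq_iff)
  finally show ?thesis by simp
qed

lemma markov_pmf:
  fixes f :: "'a \<Rightarrow> real"
  assumes "finite (set_pmf p)" "c > 0" "\<And>x. x \<in> set_pmf p \<Longrightarrow> 0 \<le> f x"
    "\<And>x. x \<in> set_pmf p \<Longrightarrow> P x \<Longrightarrow> c \<le> f x"
  shows "measure_pmf.prob p {x. P x} \<le> measure_pmf.expectation p f / c"
proof -
  have "measure_pmf.expectation p (\<lambda>x. c * indicator {x. P x} x) \<le> measure_pmf.expectation p f"
    using assms by (intro expectation_mono_finite) (auto simp: indicator_def)
  then show ?thesis using assms by (simp add: field_simps)
qed

text \<open>A path is encoded by its start and its list of steps, so that cutting the list cuts the
  path into independent pieces. The start counts: \<open>n\<close> steps have \<open>n + 1\<close>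
  positions, as in \<open>local_time n\<close>.\<close>

fun hits :: "'a::ab_group_add set \<Rightarrow> 'a \<Rightarrow> 'a list \<Rightarrow> nat" where
  "hits A x [] = of_bool (x \<in> A)"
| "hits A x (s # xs) = of_bool (x \<in> A) + hits A (x + s) xs"

text \<open>Only an inequality, as the end of \<open>xs\<close> is the start of \<open>ys\<close>
  and counts on both sides.\<close>

lemma hits_append_le: "hits A x (xs @ ys) \<le> hits A x xs + hits A (x + sum_list xs) ys"
proof (induction xs arbitrary: x)
  case Nil
  then show ?case by simp
next
  case (Cons s xs)
  from Cons[of "x + s"] show ?case by (simp add: add.assoc)
qed

lemma hits_append_ge: "hits A x xs \<le> hits A x (xs @ ys)"
proof (induction xs arbitrary: x)
  case Nil
  then show ?case by (cases ys) auto
qed simp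

lemma hits_le_length: "hits A x xs \<le> length xs + 1"
  by (induction xs arbitrary: x) (auto intro: le_SucI)

lemma hits_mono: "A \<subseteq> B \<Longrightarrow> hits A x xs \<le> hits B x xs"
  by (induction xs arbitrary: x) (auto intro!: add_mono le_SucI)

lemma hits_singleton_translate: "hits {z} x xs = hits {z - x} 0 xs"
proof -
  have "hits {z + y} (x + y) xs = hits {z} x xs" for z x y
  proof (induction xs arbitrary: x)
    case (Cons s xs)
    from Cons[of "x + s"] show ?case by (simp add: add_ac)
  qed (simp add: eq_commute)
  from this[of "z - x" x 0] show ?thesis by simp
qed

lemma hits_eq_sum_singletons:
  assumes "finite A"
  shows "hits A x xs = (\<Sum>z\<in>A. hits {z} x xs)"
proof (induction xs arbitrary: x)
  case Nil
  have "(\<Sum>z\<in>A. of_bool (x = z) :: nat) = of_bool (x \<in> A)"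
    using assms by (simp add: of_bool_def)
  then show ?case by simp
next
  case (Cons s xs)
  have "(\<Sum>z\<in>A. of_bool (x = z) :: nat) = of_bool (x \<in> A)"
    using assms by (simp add: of_bool_def)
  then show ?case using Cons by (simp add: sum.distrib)
qed

lemma hits_pos_finite: "finite {z. 0 < hits {z} x xs} \<and> card {z. 0 < hits {z} x xs} \<le> length xs + 1"
proof (induction xs arbitrary: x)
  case Nil
  have "{z. 0 < hits {z} x []} = {x}" by auto
  then show ?case by simp
next
  case (Cons s xs)
  have "{z. 0 < hits {z} x (s # xs)} = insert x {z. 0 < hits {z} (x + s) xs}" by auto
  then show ?case using Cons[of "x + s"] card_insert_le_m1 by (auto simp: card_insert_if)
qed

text \<open>A one-sided version of the level set, which can only grow when the path is
  prolonged.\<close>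

definition heavy :: "real \<Rightarrow> 'a::ab_group_add \<Rightarrow> 'a list \<Rightarrow> 'a set" where
  "heavy t x xs = {z. t \<le> real (hits {z} x xs)}"

lemma
  assumes "t > 0"
  shows finite_heavy: "finite (heavy t x xs)"
    and card_heavy_le: "card (heavy t x xs) \<le> length xs + 1"
proof -
  have "heavy t x xs \<subseteq> {z. 0 < hits {z} x xs}"
    using assms by (auto simp: heavy_def intro: Nat.gr0I)
  then show "finite (heavy t x xs)" "card (heavy t x xs) \<le> length xs + 1"
    using hits_pos_finite[of x xs] by (auto intro: finite_subset order_trans[OF card_mono])
qed

lemma card_heavy_translate: "card (heavy t x xs) = card (heavy t 0 xs)"
proof -
  have "heavy t x xs = (\<lambda>z. z + x) ` heavy t 0 xs"
    by (auto simp: heavy_def hits_singleton_translate[of _ x] image_iff)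
      (metis diff_add_cancel)
  then show ?thesis by (simp add: card_image inj_on_def)
qed

text \<open>Turns many heavy sites into many visits to a single set, which is what Khas'minskii's
  lemma controls.\<close>

lemma hits_heavy_ge:
  assumes "t > 0" "B \<subseteq> heavy t x xs"
  shows "t * real (card B) \<le> real (hits B x xs)"
proof -
  have fin: "finite B" using finite_heavy[OF assms(1)] assms(2) finite_subset by blast
  have "t * real (card B) = (\<Sum>z\<in>B. t)" by simp
  also have "\<dots> \<le> (\<Sum>z\<in>B. real (hits {z} x xs))"
    using assms(2) by (intro sum_mono) (auto simp: heavy_def)
  finally show ?thesis using hits_eq_sum_singletons[OF fin] by simp
qed

section \<open>Exponential moments and tails of visit counts\<close>

text \<open>A finite-horizon form of Khas'minskii's lemma. The induction on \<open>n\<close> rests on the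
  inequality \<open>(1 + a) (1 + w / g) \<le> 1 + 1 / g + w / g\<close> for \<open>a = 1 / (2 g)\<close> and \<open>w \<le> g\<close>.\<close>

lemma khasminskii_exp_moment:
  fixes p :: "'a::ab_group_add pmf"
  assumes fin: "finite (set_pmf p)" and g: "g > 0"
    and G: "\<And>n x. measure_pmf.expectation (replicate_pmf n p) (\<lambda>xs. real (hits A x xs)) \<le> g"
  shows "measure_pmf.expectation (replicate_pmf n p) (\<lambda>xs. (1 + 1 / (2 * g)) ^ hits A x xs)
     \<le> 1 + measure_pmf.expectation (replicate_pmf n p) (\<lambda>xs. real (hits A x xs)) / g"
proof (induction n arbitrary: x)
  case 0
  then show ?case using g by (simp add: field_simps)
next
  case (Suc n)
  let ?a = "1 / (2 * g)"
  define W where "W n x = measure_pmf.expectation (replicate_pmf n p) (\<lambda>xs. real (hits A x xs))" for n x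
  define F where "F n x = measure_pmf.expectation (replicate_pmf n p) (\<lambda>xs. (1 + ?a) ^ hits A x xs)" for n x
  define w where "w = measure_pmf.expectation p (\<lambda>s. W n (x + s))"
  have int: "integrable p f" for f :: "'a \<Rightarrow> real"
    using fin by (rule integrable_measure_pmf_finite)
  have int': "integrable (replicate_pmf n p) f" for f :: "'a list \<Rightarrow> real"
    by (intro integrable_measure_pmf_finite finite_set_replicate_pmf fin)
  have WS: "W (Suc n) x = of_bool (x \<in> A) + w"
    unfolding W_def w_def expectation_replicate_pmf_Suc[OF fin] by (simp add: int int')
  have "F (Suc n) x = (1 + ?a) ^ (of_bool (x \<in> A)) * measure_pmf.expectation p (\<lambda>s. F n (x + s))"
    unfolding F_def expectation_replicate_pmf_Suc[OF fin] by (simp add: power_add)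
  also have "measure_pmf.expectation p (\<lambda>s. F n (x + s)) \<le>
      measure_pmf.expectation p (\<lambda>s. 1 + W n (x + s) / g)"
    using Suc unfolding F_def W_def by (intro expectation_mono_finite fin) auto
  also have "measure_pmf.expectation p (\<lambda>s. 1 + W n (x + s) / g) = 1 + w / g"
    by (simp add: w_def int)
  finally have le: "F (Suc n) x \<le> (1 + ?a) ^ (of_bool (x \<in> A)) * (1 + w / g)"
    using g by (simp add: mult_left_mono)
  have w: "w \<le> g"
  proof -
    have "w \<le> measure_pmf.expectation p (\<lambda>s. g)"
      unfolding w_def by (intro expectation_mono_finite fin) (auto simp: W_def G)
    then show ?thesis by simp
  qed
  have "(1 + ?a) ^ (of_bool (x \<in> A)) * (1 + w / g) \<le> 1 + W (Suc n) x / g"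
  proof (cases "x \<in> A")
    case True
    have "?a * (1 + w / g) \<le> ?a * 2"
      using w g by (intro mult_left_mono) (auto simp: field_simps)
    then show ?thesis using True g unfolding WS by (simp add: field_simps)
  next
    case False
    then show ?thesis unfolding WS by simp
  qed
  then show ?case using le unfolding F_def W_def by linarith
qed

text \<open>Markov's inequality for the exponential moment, which is at most \<open>2\<close> as the
  mean is at most \<open>g\<close>. The assumption \<open>g \<ge> 1\<close> gives
  \<open>exp (1 / (4 * g)) \<le> 1 + 1 / (2 * g)\<close> and so the rate
  \<open>1 / (4 * g)\<close>.\<close>

lemma khasminskii_tail:
  fixes p :: "'a::ab_group_add pmf"
  assumes fin: "finite (set_pmf p)" and g: "g \<ge> 1"
    and G: "\<And>n x. measure_pmf.expectation (replicate_pmf n p) (\<lambda>xs. real (hits A x xs)) \<le> g"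
  shows "measure_pmf.prob (replicate_pmf n p) {xs. u \<le> real (hits A x xs)} \<le> 2 * exp (- (u / (4 * g)))"
proof -
  have "exp (1 / (4 * g)) \<le> 1 + 1 / (4 * g) + (1 / (4 * g))\<^sup>2"
    using g by (intro exp_bound) (auto simp: field_simps)
  also have "\<dots> \<le> 1 + 1 / (2 * g)"
    using g by (simp add: field_simps power2_eq_square)
  finally have e: "exp (1 / (4 * g)) \<le> 1 + 1 / (2 * g)" .
  have "measure_pmf.prob (replicate_pmf n p) {xs. u \<le> real (hits A x xs)} \<le>
    measure_pmf.expectation (replicate_pmf n p) (\<lambda>xs. (1 + 1 / (2 * g)) ^ hits A x xs) / exp (u / (4 * g))"
  proof (rule markov_pmf)
    fix xs assume "u \<le> real (hits A x xs)"
    then have "exp (u / (4 * g)) \<le> exp (real (hits A x xs) * (1 / (4 * g)))"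
      using g by (simp add: divide_right_mono)
    also have "\<dots> = exp (1 / (4 * g)) ^ hits A x xs" by (rule exp_of_nat_mult)
    also have "\<dots> \<le> (1 + 1 / (2 * g)) ^ hits A x xs" using e by (intro power_mono) auto
    finally show "exp (u / (4 * g)) \<le> (1 + 1 / (2 * g)) ^ hits A x xs" .
  qed (use g in \<open>auto intro!: finite_set_replicate_pmf fin\<close>)
  also have "\<dots> \<le> 2 / exp (u / (4 * g))"
  proof (intro divide_right_mono)
    have "measure_pmf.expectation (replicate_pmf n p) (\<lambda>xs. real (hits A x xs)) / g \<le> 1"
      using G[of n x] g by simp
    then show "measure_pmf.expectation (replicate_pmf n p) (\<lambda>xs. (1 + 1 / (2 * g)) ^ hits A x xs) \<le> 2"
      using khasminskii_exp_moment[OF fin _ G, of n x] g by linarith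
  qed simp
  finally show ?thesis by (simp add: exp_minus field_simps)
qed

section \<open>Green kernel estimate\<close>

abbreviation srw_step :: "(int ^ 'd::finite) pmf" where
  "srw_step \<equiv> pmf_of_set unit_steps"

lemma finite_unit_steps: "finite (unit_steps :: (int ^ 'd::finite) set)"
  and unit_steps_nonempty: "(unit_steps :: (int ^ 'd::finite) set) \<noteq> {}"
  by (auto simp: unit_steps_def)

lemma set_srw_step: "set_pmf srw_step = (unit_steps :: (int ^ 'd::finite) set)"
  by (simp add: set_pmf_of_set finite_unit_steps unit_steps_nonempty)

lemma finite_set_srw_step: "finite (set_pmf (srw_step :: (int ^ 'd::finite) pmf))"
  by (simp add: set_srw_step finite_unit_steps)

lemma expectation_srw_step:
  fixes x :: "int ^ 'd::finite"
  shows "measure_pmf.expectation srw_step (\<lambda>s. f (x + s)) = step_mean f x"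
proof -
  have inj: "inj (\<lambda>i::'d. axis i (1::int))" "inj (\<lambda>i::'d. axis i (-1::int))"
    by (auto simp: inj_on_def axis_eq_axis)
  have disj: "range (\<lambda>i::'d. axis i (1::int)) \<inter> range (\<lambda>i::'d. axis i (-1)) = {}"
    by (auto simp: axis_eq_axis)
  have sum: "sum g unit_steps = (\<Sum>i\<in>UNIV. g (axis i 1) + g (axis i (-1)))" for g :: "int ^ 'd \<Rightarrow> real"
    unfolding unit_steps_def using disj inj
    by (subst sum.union_disjoint) (auto simp: sum.reindex sum.distrib)
  have "real (card (unit_steps :: (int ^ 'd) set)) = 2 * real CARD('d)"
    using sum[of "\<lambda>_. 1"] by simp
  then show ?thesis
    by (simp add: integral_pmf_of_set finite_unit_steps unit_steps_nonempty sum step_mean_def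
        add_divide_distrib sum.distrib sum_divide_distrib)
qed

lemma step_mean_sum: "step_mean (\<lambda>x. \<Sum>a\<in>I. f a x) x = (\<Sum>a\<in>I. step_mean (f a) x)"
proof (induction I rule: infinite_finite_induct)
  case (insert a I)
  then show ?case
    by (simp add: step_mean_def sum.distrib add_divide_distrib sum_divide_distrib add_ac)
qed (simp_all add: step_mean_def)

lemma step_mean_iterate_indicator:
  assumes "finite A"
  shows "(step_mean ^^ k) (indicator A) = (\<lambda>x. \<Sum>z\<in>A. (step_mean ^^ k) (indicator {z}) x)"
proof (induction k)
  case 0
  have "indicator A x = (\<Sum>z\<in>A. indicator {z} x :: real)" for x
    using assms by (simp add: indicator_def of_bool_def)
  then show ?case by (auto simp: fun_eq_iff)
next
  case (Suc k)
  show ?case unfolding funpow.simps o_apply Suc by (simp add: fun_eq_iff step_mean_sum)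
qed

lemma step_mean_iterate_indicator_le_1: "(step_mean ^^ k) (indicator A) x \<le> 1"
proof (induction k arbitrary: x)
  case (Suc k)
  have "step_mean ((step_mean ^^ k) (indicator A)) x \<le> step_mean (\<lambda>_. 1) x"
    unfolding step_mean_def[of "(step_mean ^^ k) (indicator A)"] step_mean_def[of "\<lambda>_. 1"]
    by (intro divide_right_mono sum_mono add_mono Suc) auto
  also have "\<dots> = 1" by (simp add: step_mean_def)
  finally show ?case by simp
qed (simp add: indicator_def)

lemma expectation_hits:
  "measure_pmf.expectation (replicate_pmf n srw_step) (\<lambda>xs. real (hits A x xs)) =
    (\<Sum>k\<le>n. (step_mean ^^ k) (indicator A) x)"
proof (induction n arbitrary: x)
  case 0
  show ?case by (simp add: indicator_def)
next
  case (Suc n)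
  have int: "integrable srw_step f" for f :: "int ^ 'a \<Rightarrow> real"
    by (rule integrable_measure_pmf_finite[OF finite_set_srw_step])
  have int': "integrable (replicate_pmf n srw_step) f" for f :: "(int ^ 'a) list \<Rightarrow> real"
    by (intro integrable_measure_pmf_finite finite_set_replicate_pmf finite_set_srw_step)
  have "measure_pmf.expectation (replicate_pmf (Suc n) srw_step) (\<lambda>xs. real (hits A x xs)) =
     indicator A x + step_mean (\<lambda>x. \<Sum>k\<le>n. (step_mean ^^ k) (indicator A) x) x"
    unfolding expectation_replicate_pmf_Suc[OF finite_set_srw_step] Suc[symmetric] expectation_srw_step[symmetric]
    by (simp add: int int' indicator_def)
  also have "\<dots> = indicator A x + (\<Sum>k\<le>n. (step_mean ^^ Suc k) (indicator A) x)"
    by (simp add: step_mean_sum)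
  also have "\<dots> = (\<Sum>k\<le>Suc n. (step_mean ^^ k) (indicator A) x)"
    by (simp add: sum.atMost_Suc_shift del: sum.atMost_Suc)
  finally show ?case .
qed

text \<open>Telescoping, by comparison with \<open>1 / (k * (k + 1))\<close>.\<close>

lemma sum_inverse_squares_le:
  assumes "1 \<le> K" "K \<le> n"
  shows "(\<Sum>k=K..<n. 1 / (real k + 1)\<^sup>2) \<le> 1 / real K - 1 / real n"
  using assms(2)
proof (induction n rule: dec_induct)
  case (step n)
  have n: "real n \<ge> 1" using step.hyps(1) assms(1) by linarith
  have "1 / (real n + 1)\<^sup>2 \<le> 1 / (real n * (real n + 1))"
    using n by (intro frac_le) (auto simp: power2_eq_square)
  also have "\<dots> = 1 / real n - 1 / real (Suc n)"
    using n by (simp add: field_simps)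
  finally have "1 / (real n + 1)\<^sup>2 \<le> 1 / real n - 1 / real (Suc n)" .
  then show ?case using step by (simp only: sum.atLeastLessThan_Suc)
qed simp

text \<open>In \<open>expectation_hits_le\<close> the \<open>2\<close> pays for the times before
  \<open>K\<close>, and the power of \<open>d\<close> is the heat kernel constant.\<close>

definition green_const :: "nat \<Rightarrow> real" where
  "green_const d = 2 + real d powr (real d / 2)"

lemma green_const_ge_1: "1 \<le> green_const d"
  by (simp add: green_const_def add_increasing2)

text \<open>The sum over times is split at \<open>K\<close>, about \<open>M powr (2 / d)\<close>.
  Earlier times contribute at most \<open>1\<close> each. Later ones contribute at most
  \<open>M\<close> times the heat kernel bound, in total of order
  \<open>M * K powr (1 - d / 2)\<close>, which is again \<open>M powr (2 / d)\<close>.\<close>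

lemma expectation_hits_le:
  fixes A :: "(int ^ 'd::finite) set"
  assumes d: "CARD('d) \<ge> 4" and A: "finite A" "real (card A) \<le> M" and M: "M \<ge> 1"
  shows "measure_pmf.expectation (replicate_pmf n srw_step) (\<lambda>xs. real (hits A x xs))
    \<le> green_const CARD('d) * M powr (2 / real CARD('d))"
proof -
  define d where "d = real CARD('d)"
  have d4: "d \<ge> 4" using d by (simp add: d_def)
  define c where "c = d powr (d / 2)"
  define m where "m = M powr (2 / d)"
  define K where "K = nat \<lceil>m\<rceil>"
  define u where "u k = (step_mean ^^ k) (indicator A) x" for k
  have m1: "m \<ge> 1" unfolding m_def using M d4 by (simp add: ge_one_powr_ge_zero)
  have K: "m \<le> real K" "real K \<le> 2 * m" "1 \<le> K"
    unfolding K_def using m1 by linarith+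
  have c: "c \<ge> 0" by (simp add: c_def)
  have u1: "u k \<le> 1" for k unfolding u_def by (rule step_mean_iterate_indicator_le_1)
  have u2: "u k \<le> M * c * (real k + 1) powr (- (d / 2))" for k
  proof -
    have "u k \<le> (\<Sum>z\<in>A. (d / (real k + 1)) powr (d / 2))"
      unfolding u_def step_mean_iterate_indicator[OF A(1)] d_def by (intro sum_mono heat_kernel_bound)
    also have "\<dots> = real (card A) * (c * (real k + 1) powr (- (d / 2)))"
      using d4 by (simp add: c_def powr_divide powr_minus_divide)
    also have "\<dots> \<le> M * (c * (real k + 1) powr (- (d / 2)))"
      using A(2) c by (intro mult_right_mono) auto
    finally show ?thesis by simp
  qed
  \<comment> \<open>As \<open>d \<ge> 4\<close>, an inverse square can be split off while the
    remaining exponent \<open>2 - d / 2\<close> is not positive.\<close>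
  have tail: "u k \<le> M * c * real K powr (2 - d / 2) * (1 / (real k + 1)\<^sup>2)" if "k \<ge> K" for k
  proof -
    have "(real k + 1) powr (- (d / 2)) = (real k + 1) powr (2 - d / 2) * (real k + 1) powr (- 2)"
      by (simp flip: powr_add)
    also have "(real k + 1) powr (- 2) = 1 / (real k + 1)\<^sup>2"
      by (simp add: powr_minus_divide)
    also have "(real k + 1) powr (2 - d / 2) \<le> real K powr (2 - d / 2)"
      using that d4 K by (intro powr_mono2') auto
    finally have "(real k + 1) powr (- (d / 2)) \<le> real K powr (2 - d / 2) * (1 / (real k + 1)\<^sup>2)"
      by (simp add: mult_right_mono divide_right_mono)
    then have "M * c * (real k + 1) powr (- (d / 2)) \<le> M * c * (real K powr (2 - d / 2) * (1 / (real k + 1)\<^sup>2))"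
      using M c by (intro mult_left_mono) auto
    then show ?thesis using u2[of k] by (simp add: mult.assoc)
  qed
  have "(\<Sum>k\<le>n. u k) \<le> (\<Sum>k<K. 1) + (\<Sum>k=K..<K + n + 1. M * c * real K powr (2 - d / 2) * (1 / (real k + 1)\<^sup>2))"
  proof -
    have nn: "0 \<le> M * c * real K powr (2 - d / 2) * (1 / (real k + 1)\<^sup>2)" for k
      using M c by simp
    have "(\<Sum>k\<le>n. u k) = (\<Sum>k\<in>{..n} \<inter> {..<K}. u k) + (\<Sum>k\<in>{..n} - {..<K}. u k)"
      by (subst sum.union_disjoint[symmetric]) (auto intro!: sum.cong)
    also have "(\<Sum>k\<in>{..n} \<inter> {..<K}. u k) \<le> (\<Sum>k\<in>{..n} \<inter> {..<K}. 1)"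
      by (intro sum_mono u1)
    also have "\<dots> \<le> (\<Sum>k<K. 1)" by (intro sum_mono2) auto
    also have "(\<Sum>k\<in>{..n} - {..<K}. u k) \<le> (\<Sum>k\<in>{..n} - {..<K}. M * c * real K powr (2 - d / 2) * (1 / (real k + 1)\<^sup>2))"
      by (intro sum_mono tail) auto
    also have "\<dots> \<le> (\<Sum>k=K..<K + n + 1. M * c * real K powr (2 - d / 2) * (1 / (real k + 1)\<^sup>2))"
      by (intro sum_mono2 nn) auto
    finally show ?thesis by simp
  qed
  also have "\<dots> = real K + M * c * real K powr (2 - d / 2) * (\<Sum>k=K..<K + n + 1. 1 / (real k + 1)\<^sup>2)"
    by (subst sum_distrib_left) simp
  also have "\<dots> \<le> real K + M * c * real K powr (2 - d / 2) * (1 / real K)"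
  proof -
    have "(\<Sum>k=K..<K + n + 1. 1 / (real k + 1)\<^sup>2) \<le> 1 / real K - 1 / real (K + n + 1)"
      using K by (intro sum_inverse_squares_le) auto
    also have "\<dots> \<le> 1 / real K" by simp
    finally show ?thesis using M c by (intro add_left_mono mult_left_mono) auto
  qed
  also have "M * c * real K powr (2 - d / 2) * (1 / real K) = M * c * real K powr (1 - d / 2)"
    using K by (simp add: powr_diff) (simp add: power2_eq_square)
  also have "\<dots> \<le> M * c * m powr (1 - d / 2)"
    using K m1 d4 M c by (intro mult_left_mono powr_mono2') auto
  also have "m powr (1 - d / 2) = M powr (2 / d - 1)"
  proof -
    have "2 / d * (1 - d / 2) = 2 / d - 1" using d4 by (simp add: field_simps)
    then show ?thesis by (simp only: m_def powr_powr)
  qed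
  also have "M * c * M powr (2 / d - 1) = c * m"
    using M by (simp add: m_def powr_diff)
  finally have "(\<Sum>k\<le>n. u k) \<le> 2 * m + c * m" using K by linarith
  then show ?thesis
    unfolding expectation_hits u_def c_def m_def d_def green_const_def by (simp add: algebra_simps)
qed

lemma visits_tail:
  fixes A :: "(int ^ 'd::finite) set"
  assumes d: "CARD('d) \<ge> 4" and A: "finite A" "real (card A) \<le> M" and M: "M \<ge> 1"
  shows "measure_pmf.prob (replicate_pmf n srw_step) {xs. u \<le> real (hits A x xs)}
    \<le> 2 * exp (- (u / (4 * (green_const CARD('d) * M powr (2 / real CARD('d))))))"
proof (rule khasminskii_tail)
  have "1 * 1 \<le> green_const CARD('d) * M powr (2 / real CARD('d))"
    using M green_const_ge_1[of "CARD('d)"] by (intro mult_mono) (auto simp: ge_one_powr_ge_zero)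
  then show "1 \<le> green_const CARD('d) * M powr (2 / real CARD('d))" by simp
qed (use assms in \<open>auto intro: finite_set_srw_step expectation_hits_le\<close>)

section \<open>Reduction to finitely many steps\<close>

lemma pmf_replicate_pmf:
  "length ys = n \<Longrightarrow> pmf (replicate_pmf n p) ys = (\<Prod>i<n. pmf p (ys ! i))"
proof (induction n arbitrary: ys)
  case 0
  then show ?case by simp
next
  case (Suc n)
  then obtain z zs where ys: "ys = z # zs" "length zs = n" by (auto simp: length_Suc_conv)
  have "replicate_pmf (Suc n) p = map_pmf (\<lambda>(x, xs). x # xs) (pair_pmf p (replicate_pmf n p))"
    by (simp add: pair_pmf_def map_pmf_def bind_assoc_pmf bind_return_pmf)
  moreover have "inj (\<lambda>(x, xs). x # xs)" by (auto simp: inj_on_def)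
  ultimately have "pmf (replicate_pmf (Suc n) p) ys = pmf (pair_pmf p (replicate_pmf n p)) (z, zs)"
    using pmf_map_inj'[of "\<lambda>(x, xs). x # xs" _ "(z, zs)"] ys by simp
  then show ?case
    using Suc.IH[OF ys(2)] by (simp add: pmf_pair ys(1) prod.lessThan_Suc_shift del: prod.lessThan_Suc)
qed

text \<open>Lists over a countable type form a countable set, so singletons suffice; their preimages
  are cylinder sets.\<close>

lemma distr_PiM_replicate_pmf:
  fixes p :: "'a::countable pmf"
  defines "S \<equiv> \<Pi>\<^sub>M i\<in>(UNIV :: nat set). measure_pmf p"
  shows "(\<lambda>\<omega>. map \<omega> [0..<n]) \<in> S \<rightarrow>\<^sub>M count_space UNIV"
    and "distr S (count_space UNIV) (\<lambda>\<omega>. map \<omega> [0..<n]) = measure_pmf (replicate_pmf n p)"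
proof -
  interpret product_prob_space "\<lambda>_. measure_pmf p" "UNIV :: nat set"
    by unfold_locales
  have space: "space S = UNIV" by (simp add: S_def space_PiM)
  have vim: "(\<lambda>\<omega>. map \<omega> [0..<n]) -` {ys} \<inter> space S = (if length ys = n
      then prod_emb UNIV (\<lambda>_. measure_pmf p) {..<n} (\<Pi>\<^sub>E i\<in>{..<n}. {ys ! i}) else {})" for ys
    by (auto simp: space prod_emb_def restrict_def PiE_iff extensional_def intro!: nth_equalityI)
      (metis add_0 diff_zero nth_map_upt)
  have em: "prod_emb UNIV (\<lambda>_. measure_pmf p) {..<n} (\<Pi>\<^sub>E i\<in>{..<n}. {ys ! i}) \<in> sets S" for ys
    unfolding S_def by (intro sets_PiM_I) auto
  show meas: "(\<lambda>\<omega>. map \<omega> [0..<n]) \<in> S \<rightarrow>\<^sub>M count_space UNIV"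
    unfolding measurable_count_space_eq2_countable vim using em by auto
  show "distr S (count_space UNIV) (\<lambda>\<omega>. map \<omega> [0..<n]) = measure_pmf (replicate_pmf n p)"
  proof (rule measure_eqI_countable[where A = UNIV])
    fix ys :: "'a list"
    have "emeasure (distr S (count_space UNIV) (\<lambda>\<omega>. map \<omega> [0..<n])) {ys} =
        emeasure S ((\<lambda>\<omega>. map \<omega> [0..<n]) -` {ys} \<inter> space S)"
      by (rule emeasure_distr[OF meas]) simp
    also have "\<dots> = emeasure (measure_pmf (replicate_pmf n p)) {ys}"
    proof (cases "length ys = n")
      case True
      have "emeasure S (prod_emb UNIV (\<lambda>_. measure_pmf p) {..<n} (\<Pi>\<^sub>E i\<in>{..<n}. {ys ! i}))
          = (\<Prod>i<n. emeasure (measure_pmf p) {ys ! i})"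
        unfolding S_def by (intro emeasure_PiM_emb) auto
      then show ?thesis
        using True by (simp add: vim emeasure_pmf_single pmf_replicate_pmf prod_ennreal)
    next
      case False
      then have "ys \<notin> set_pmf (replicate_pmf n p)" by (auto simp: set_replicate_pmf)
      then show ?thesis using False by (simp add: vim emeasure_pmf_single set_pmf_iff)
    qed
    finally show "emeasure (distr S (count_space UNIV) (\<lambda>\<omega>. map \<omega> [0..<n])) {ys} =
      emeasure (measure_pmf (replicate_pmf n p)) {ys}" .
  qed auto
qed

lemma hits_snoc: "hits A x (xs @ [s]) = hits A x xs + of_bool (x + sum_list xs + s \<in> A)"
  by (induction xs arbitrary: x) (auto simp: add.assoc)

lemma hits_map_upt: "hits A x (map \<omega> [0..<n]) = (\<Sum>k\<le>n. of_bool (x + (\<Sum>i<k. \<omega> i) \<in> A))"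
proof (induction n)
  case (Suc n)
  have "sum_list (map \<omega> [0..<n]) = (\<Sum>i<n. \<omega> i)"
    by (simp add: interv_sum_list_conv_sum_set_nat atLeast0LessThan)
  then show ?case using Suc by (simp add: hits_snoc add.assoc)
qed simp

lemma local_time_eq_hits: "local_time n x \<omega> = real (hits {x} 0 (map \<omega> [0..<n]))"
  unfolding local_time_def hits_map_upt walk_def of_nat_sum by (intro sum.cong) (auto simp: indicator_def)

text \<open>Horizon \<open>n\<close> and level \<open>t\<close> are separate parameters because the
  induction over time scales changes both.\<close>

definition heavy_tail :: "'d::finite itself \<Rightarrow> nat \<Rightarrow> real \<Rightarrow> nat \<Rightarrow> real" where
  "heavy_tail _ n t s = measure_pmf.prob (replicate_pmf n (srw_step :: (int ^ 'd) pmf)) {xs. s \<le> card (heavy t 0 xs)}"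

text \<open>The level set is contained in the heavy set of level \<open>real n powr b\<close>, and a
  cardinality exceeding \<open>u\<close> is at least
  \<open>nat \<lfloor>u\<rfloor> + 1\<close>.\<close>

lemma level_prob_le_heavy_tail:
  assumes n: "n \<ge> 1" and u: "u \<ge> 0"
  shows "level_prob TYPE('d::finite) n b a u \<le> heavy_tail TYPE('d) n (real n powr b) (nat \<lfloor>u\<rfloor> + 1)"
proof -
  let ?S = "rw_measure :: (nat \<Rightarrow> int ^ 'd) measure"
  let ?f = "\<lambda>\<omega> :: nat \<Rightarrow> int ^ 'd. map \<omega> [0..<n]"
  let ?E = "{xs :: (int ^ 'd) list. nat \<lfloor>u\<rfloor> + 1 \<le> card (heavy (real n powr b) 0 xs)}"
  have t: "real n powr b > 0" using n by simp
  interpret prob_space ?S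
    unfolding rw_measure_def by (intro prob_space_PiM) (rule prob_space_measure_pmf)
  have meas: "?f \<in> ?S \<rightarrow>\<^sub>M count_space UNIV"
    and distr: "distr ?S (count_space UNIV) ?f = measure_pmf (replicate_pmf n srw_step)"
    unfolding rw_measure_def by (rule distr_PiM_replicate_pmf)+
  have "{\<omega> \<in> space ?S. u < real (card (level_set n b a \<omega>))} \<subseteq> ?f -` ?E \<inter> space ?S"
  proof
    fix \<omega> :: "nat \<Rightarrow> int ^ 'd"
    assume "\<omega> \<in> {\<omega> \<in> space ?S. u < real (card (level_set n b a \<omega>))}"
    then have \<omega>: "\<omega> \<in> space ?S" and *: "u < real (card (level_set n b a \<omega>))" by auto
    have "card (level_set n b a \<omega>) \<le> card (heavy (real n powr b) 0 (?f \<omega>))"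
      by (intro card_mono finite_heavy[OF t]) (auto simp: level_set_def heavy_def local_time_eq_hits)
    with * u have "nat \<lfloor>u\<rfloor> + 1 \<le> card (heavy (real n powr b) 0 (?f \<omega>))" by linarith
    with \<omega> show "\<omega> \<in> ?f -` ?E \<inter> space ?S" by simp
  qed
  \<comment> \<open>Monotonicity asks for measurability of the larger event, which depends on
    finitely many steps.\<close>
  then have "level_prob TYPE('d) n b a u \<le> measure ?S (?f -` ?E \<inter> space ?S)"
    unfolding level_prob_def by (intro finite_measure_mono measurable_sets[OF meas]) auto
  also have "\<dots> = measure (distr ?S (count_space UNIV) ?f) ?E"
    by (intro measure_distr[symmetric] meas) simp
  finally show ?thesis unfolding distr heavy_tail_def .
qed

section \<open>Blocks and cuts\<close>

text \<open>Start of the induction over set sizes: \<open>n\<close> steps visit at most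
  \<open>n + 1\<close> sites.\<close>

lemma heavy_tail_eq_0_many_sites:
  assumes "t > 0" "s > n + 1"
  shows "heavy_tail D n t s = 0"
proof -
  have "\<not> s \<le> card (heavy t 0 xs)" if "xs \<in> set_pmf (replicate_pmf n srw_step)" for xs :: "(int ^ 'a) list"
    using card_heavy_le[OF assms(1), of 0 xs] that assms(2) by (auto simp: set_replicate_pmf)
  then show ?thesis
    unfolding heavy_tail_def by (auto simp: measure_pmf_zero_iff)
qed

text \<open>Start of the induction over time scales: no site has more than \<open>n + 1\<close>
  visits.\<close>

lemma heavy_tail_eq_0_high_level:
  assumes "t > real n + 1" "s > 0"
  shows "heavy_tail D n t s = 0"
proof -
  have "heavy t 0 xs = {}" if "xs \<in> set_pmf (replicate_pmf n srw_step)" for xs :: "(int ^ 'a) list"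
  proof -
    have "real (hits {z} 0 xs) < t" for z
    proof -
      have "real (hits {z} 0 xs) \<le> real (n + 1)"
        using that hits_le_length[of "{z}" 0 xs] by (auto simp: set_replicate_pmf)
      then show ?thesis using assms(1) by simp
    qed
    then show ?thesis by (auto simp: heavy_def not_le)
  qed
  then show ?thesis
    unfolding heavy_tail_def using assms(2) by (auto simp: measure_pmf_zero_iff)
qed

text \<open>Prolonging the path only adds visits. This compares the part before a cut with the whole
  path, and lets \<open>n\<close> be rounded up to a time scale.\<close>

lemma heavy_tail_mono_time:
  assumes t: "t > 0" and "m \<le> n"
  shows "heavy_tail D m t s \<le> heavy_tail D n t s"
proof -
  obtain k where n: "n = m + k" using assms(2) by (auto simp: le_iff_add)
  let ?R = "\<lambda>n. replicate_pmf n (srw_step :: (int ^ 'a) pmf)"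
  have sub: "heavy t 0 xs \<subseteq> heavy t 0 (xs @ ys)" for xs ys :: "(int ^ 'a) list"
    using hits_append_ge[of _ 0 xs ys] by (auto simp: heavy_def intro: order_trans)
  have "heavy_tail D m t s = measure_pmf.expectation (?R m) (indicator {xs. s \<le> card (heavy t 0 xs)})"
    by (simp add: heavy_tail_def)
  also have "\<dots> \<le> measure_pmf.expectation (?R m)
      (\<lambda>xs. measure_pmf.prob (?R k) {ys. s \<le> card (heavy t 0 (xs @ ys))})"
  proof (intro expectation_mono_finite finite_set_replicate_pmf finite_set_srw_step)
    fix xs :: "(int ^ 'a) list"
    have "measure_pmf.prob (?R k) {ys. s \<le> card (heavy t 0 (xs @ ys))} = 1" if "s \<le> card (heavy t 0 xs)"
    proof -
      have "{ys. s \<le> card (heavy t 0 (xs @ ys))} = UNIV"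
        using that card_mono[OF finite_heavy[OF t] sub] by (auto intro: order_trans)
      then show ?thesis by simp
    qed
    then show "indicator {xs. s \<le> card (heavy t 0 xs)} xs
        \<le> measure_pmf.prob (?R k) {ys. s \<le> card (heavy t 0 (xs @ ys))}"
      by (auto simp: indicator_def)
  qed
  also have "\<dots> = heavy_tail D n t s"
    unfolding heavy_tail_def n by (rule prob_replicate_pmf_add[OF finite_set_srw_step, symmetric])
  finally show ?thesis .
qed

definition cut_heavy :: "real \<Rightarrow> nat \<Rightarrow> 'a::ab_group_add list \<Rightarrow> 'a set" where
  "cut_heavy t m xs = heavy t 0 (take m xs) \<inter> heavy t (sum_list (take m xs)) (drop m xs)"

text \<open>Look at the first cut before which a site has a quarter of its visits: unless the last block
  before that cut carries half of the visits, a quarter of them is left for the time after it.\<close>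

lemma heavy_subset_blocks_cuts:
  assumes t: "t > 0" and len: "length xs = Q * K"
  shows "heavy t 0 xs \<subseteq>
    (\<Union>i<Q. heavy (t / 2) (sum_list (take (i * K) xs)) (take K (drop (i * K) xs))) \<union>
    (\<Union>j\<le>Q. cut_heavy (t / 4) (j * K) xs)"
proof
  fix z assume z: "z \<in> heavy t 0 xs"
  define pre where "pre j = real (hits {z} 0 (take (j * K) xs))" for j
  define suf where "suf j = real (hits {z} (sum_list (take (j * K) xs)) (drop (j * K) xs))" for j
  define blk where "blk i = real (hits {z} (sum_list (take (i * K) xs)) (take K (drop (i * K) xs)))" for i
  have tz: "t \<le> real (hits {z} 0 xs)" using z by (simp add: heavy_def)
  have whole: "real (hits {z} 0 xs) \<le> pre j + suf j" for j
    using hits_append_le[of "{z}" 0 "take (j * K) xs" "drop (j * K) xs"]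
    by (simp add: pre_def suf_def)
  have step: "pre (Suc i) \<le> pre i + blk i" for i
  proof -
    have "take (Suc i * K) xs = take (i * K) xs @ take K (drop (i * K) xs)"
      using take_add[of "i * K" K xs] by (simp add: add.commute)
    then show ?thesis
      using hits_append_le[of "{z}" 0 "take (i * K) xs" "take K (drop (i * K) xs)"]
      unfolding pre_def blk_def by simp
  qed
  have "pre Q \<ge> t / 4" using tz t len by (simp add: pre_def)
  define j where "j = (LEAST j. t / 4 \<le> pre j)"
  have j: "t / 4 \<le> pre j" unfolding j_def by (rule LeastI[of _ Q]) fact
  have jQ: "j \<le> Q" unfolding j_def by (rule Least_le) fact
  have "z \<in> cut_heavy (t / 4) (j * K) xs" if "suf j \<ge> t / 4"
    using that j by (simp add: cut_heavy_def heavy_def pre_def suf_def)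
  moreover have "\<exists>i<Q. blk i \<ge> t / 2" if s: "suf j < t / 4"
  proof (cases j)
    \<comment> \<open>The path after the cut at time \<open>0\<close> is the whole path and carries
      all \<open>t\<close> visits, so \<open>suf j < t / 4\<close> is impossible.\<close>
    case 0
    have "pre 0 + suf 0 \<le> 1 + suf 0" "real (hits {z} 0 xs) = suf 0" by (simp_all add: pre_def suf_def)
    then show ?thesis using s tz t 0 by simp
  next
    case (Suc i)
    then have "pre i < t / 4" using not_less_Least[of i "\<lambda>j. t / 4 \<le> pre j"] by (simp add: j_def)
    then have "blk i \<ge> t / 2" using whole[of j] step[of i] s tz t Suc by simp
    then show ?thesis using Suc jQ by (intro exI[of _ i]) auto
  qed
  ultimately show "z \<in> (\<Union>i<Q. heavy (t / 2) (sum_list (take (i * K) xs)) (take K (drop (i * K) xs))) \<union>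
    (\<Union>j\<le>Q. cut_heavy (t / 4) (j * K) xs)"
    using jQ by (cases "suf j < t / 4") (auto simp: blk_def heavy_def not_less)
qed

lemma expectation_prod_blocks:
  fixes g :: "'a list \<Rightarrow> real"
  assumes fin: "finite (set_pmf p)"
  shows "measure_pmf.expectation (replicate_pmf (Q * K) p) (\<lambda>xs. \<Prod>i<Q. g (take K (drop (i * K) xs)))
    = measure_pmf.expectation (replicate_pmf K p) g ^ Q"
proof (induction Q)
  case (Suc Q)
  have "measure_pmf.expectation (replicate_pmf (Suc Q * K) p) (\<lambda>xs. \<Prod>i<Suc Q. g (take K (drop (i * K) xs)))
     = measure_pmf.expectation (replicate_pmf K p) (\<lambda>xs. measure_pmf.expectation (replicate_pmf (Q * K) p)
         (\<lambda>ys. \<Prod>i<Suc Q. g (take K (drop (i * K) (xs @ ys)))))"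
    using expectation_replicate_pmf_add[OF fin, of K "Q * K"] by simp
  also have "\<dots> = measure_pmf.expectation (replicate_pmf K p) (\<lambda>xs. measure_pmf.expectation (replicate_pmf (Q * K) p)
         (\<lambda>ys. g xs * (\<Prod>i<Q. g (take K (drop (i * K) ys)))))"
    by (intro integral_cong_AE)
      (auto simp: AE_measure_pmf_iff set_replicate_pmf prod.lessThan_Suc_shift simp del: prod.lessThan_Suc)
  also have "\<dots> = measure_pmf.expectation (replicate_pmf K p) g ^ Suc Q"
    using Suc by simp
  finally show ?case .
qed simp

text \<open>Exponential Markov inequality for independent blocks. For \<open>q < 1\<close> the
  assumed tail does not bound an exponential moment of \<open>N\<close>, so \<open>N\<close> is
  truncated at \<open>s\<close>. By \<open>small\<close> the product of the \<open>Q\<close>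
  truncated moments is at most \<open>exp 1\<close>.\<close>

lemma block_sum_tail:
  fixes N :: "'a list \<Rightarrow> nat"
  assumes fin: "finite (set_pmf p)" and s: "s \<ge> 1" and a: "a \<ge> 0" and q: "0 \<le> q" "q \<le> 1"
    and tail: "\<And>r. r \<ge> 1 \<Longrightarrow> measure_pmf.prob (replicate_pmf K p) {xs. r \<le> N xs} \<le> exp (- (a * real r powr q))"
    and small: "real Q * real s * exp (- (a / 2)) \<le> 1"
  shows "measure_pmf.prob (replicate_pmf (Q * K) p) {xs. real s / 2 \<le> (\<Sum>i<Q. real (N (take K (drop (i * K) xs))))}
    \<le> exp (1 - a * real s powr q / 4)"
proof -
  let ?R = "replicate_pmf K p"
  \<comment> \<open>Up to \<open>r = s\<close> the line with slope \<open>l\<close> stays below half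
    of the tail exponent, \<open>a * real r powr q / 2\<close>.\<close>
  define l where "l = a * real s powr (q - 1) / 2"
  define g where "g xs = exp (l * real (min (N xs) s))" for xs
  define S where "S r = {xs. r \<le> N xs}" for r
  have l: "l \<ge> 0" using a by (simp add: l_def)
  have int: "integrable ?R f" for f :: "'a list \<Rightarrow> real"
    by (intro integrable_measure_pmf_finite finite_set_replicate_pmf fin)
  have "measure_pmf.expectation ?R g \<le>
      measure_pmf.expectation ?R (\<lambda>xs. 1 + (\<Sum>r=1..s. exp (l * real r) * indicator (S r) xs))"
  proof (intro expectation_mono_finite finite_set_replicate_pmf fin)
    fix xs
    \<comment> \<open>If \<open>min (N xs) s\<close> is positive, the summand with this
      \<open>r\<close> is already \<open>g xs\<close>.\<close>
    show "g xs \<le> 1 + (\<Sum>r=1..s. exp (l * real r) * indicator (S r) xs)"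
    proof (cases "min (N xs) s = 0")
      case True
      then have "g xs = 1" by (simp only: g_def) simp
      then show ?thesis by (simp add: sum_nonneg)
    next
      case False
      have "(\<Sum>r\<in>{min (N xs) s}. exp (l * real r) * indicator (S r) xs)
         \<le> (\<Sum>r=1..s. exp (l * real r) * indicator (S r) xs :: real)"
        using False by (intro sum_mono2) auto
      then show ?thesis by (simp add: g_def S_def)
    qed
  qed
  also have "\<dots> = 1 + (\<Sum>r=1..s. exp (l * real r) * measure_pmf.prob ?R (S r))"
    by (simp add: int del: sum_mult_indicator)
  also have "\<dots> \<le> 1 + (\<Sum>r=1..s. exp (- (a / 2)))"
  proof (intro add_left_mono sum_mono)
    fix r assume r: "r \<in> {1..s}"
    have "real s powr (q - 1) \<le> real r powr (q - 1)" using r q by (intro powr_mono2') auto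
    then have "real r * real s powr (q - 1) \<le> real r * real r powr (q - 1)" by (intro mult_left_mono) auto
    also have "\<dots> = real r powr q" using r by (simp add: powr_diff)
    finally have "l * real r \<le> a * real r powr q / 2"
      using a by (simp add: l_def mult_left_mono mult.assoc mult.commute[of "real s powr _"])
    moreover have "a * 1 \<le> a * real r powr q"
      using r q a by (intro mult_left_mono ge_one_powr_ge_zero) auto
    ultimately have e: "l * real r - a * real r powr q \<le> - (a / 2)" by linarith
    have "exp (l * real r) * measure_pmf.prob ?R (S r) \<le> exp (l * real r) * exp (- (a * real r powr q))"
      using r tail unfolding S_def by (intro mult_left_mono) auto
    also have "\<dots> = exp (l * real r - a * real r powr q)" by (simp add: exp_diff exp_minus field_simps)
    also have "\<dots> \<le> exp (- (a / 2))" using e by simp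
    finally show "exp (l * real r) * measure_pmf.prob ?R (S r) \<le> exp (- (a / 2))" .
  qed
  also have "\<dots> \<le> exp (real s * exp (- (a / 2)))" by simp
  finally have "measure_pmf.expectation ?R g ^ Q \<le> exp (real s * exp (- (a / 2))) ^ Q"
    by (intro power_mono) (auto simp: g_def)
  also have "\<dots> = exp (real Q * (real s * exp (- (a / 2))))" by (simp add: exp_of_nat_mult)
  also have "\<dots> \<le> exp 1" using small by (simp add: mult.assoc)
  finally have E: "measure_pmf.expectation ?R g ^ Q \<le> exp 1" .
  have "measure_pmf.prob (replicate_pmf (Q * K) p) {xs. real s / 2 \<le> (\<Sum>i<Q. real (N (take K (drop (i * K) xs))))}
    \<le> measure_pmf.expectation (replicate_pmf (Q * K) p) (\<lambda>xs. \<Prod>i<Q. g (take K (drop (i * K) xs)))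
      / exp (l * (real s / 2))"
  proof (rule markov_pmf)
    fix xs :: "'a list"
    let ?N = "\<lambda>i. N (take K (drop (i * K) xs))"
    assume le: "real s / 2 \<le> (\<Sum>i<Q. real (?N i))"
    \<comment> \<open>Truncation keeps the event: one block reaching \<open>s\<close> makes the
      truncated sum at least \<open>s\<close>.\<close>
    have "real s / 2 \<le> (\<Sum>i<Q. real (min (?N i) s))"
    proof (cases "\<exists>i<Q. ?N i \<ge> s")
      case True
      then obtain i where i: "i < Q" "?N i \<ge> s" by auto
      have "real (min (?N i) s) \<le> (\<Sum>i<Q. real (min (?N i) s))"
        using i by (intro member_le_sum) auto
      moreover have "min (?N i) s = s" using i by simp
      ultimately show ?thesis by linarith
    next
      case False
      then have "(\<Sum>i<Q. real (min (?N i) s)) = (\<Sum>i<Q. real (?N i))"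
        by (intro sum.cong) (auto simp: min_def not_le)
      then show ?thesis using le by simp
    qed
    then have "exp (l * (real s / 2)) \<le> exp (l * (\<Sum>i<Q. real (min (?N i) s)))"
      using l by (simp only: exp_le_cancel_iff) (intro mult_left_mono)
    also have "\<dots> = (\<Prod>i<Q. g (take K (drop (i * K) xs)))"
      by (simp only: g_def sum_distrib_left exp_sum finite_lessThan)
    finally show "exp (l * (real s / 2)) \<le> (\<Prod>i<Q. g (take K (drop (i * K) xs)))" .
  qed (auto intro!: finite_set_replicate_pmf fin prod_nonneg simp: g_def)
  also have "\<dots> \<le> exp 1 / exp (l * (real s / 2))"
    unfolding expectation_prod_blocks[OF fin] by (intro divide_right_mono E) auto
  also have "l * (real s / 2) = a * real s powr q / 4"
    using s by (simp add: l_def powr_diff)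
  finally show ?thesis by (simp add: exp_diff)
qed

text \<open>Conditioning on the path up to the cut. Either it has \<open>M\<close> heavy sites, or
  its heavy sites form a fixed set of fewer than \<open>M\<close> points to which the independent
  rest makes \<open>t * r\<close> visits, and \<open>visits_tail\<close> applies.\<close>

lemma cut_heavy_tail:
  assumes d: "CARD('d::finite) \<ge> 4" and t: "t > 0" and m: "m \<le> n" and M: "M \<ge> 1"
  shows "measure_pmf.prob (replicate_pmf n (srw_step :: (int ^ 'd) pmf)) {xs. r \<le> real (card (cut_heavy t m xs))}
    \<le> heavy_tail TYPE('d) n t M
      + 2 * exp (- (t * r / (4 * (green_const CARD('d) * real M powr (2 / real CARD('d))))))"
proof -
  obtain k where n: "n = m + k" using m by (auto simp: le_iff_add)
  let ?R = "\<lambda>n. replicate_pmf n (srw_step :: (int ^ 'd) pmf)"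
  let ?e = "2 * exp (- (t * r / (4 * (green_const CARD('d) * real M powr (2 / real CARD('d))))))"
  have "measure_pmf.prob (?R n) {xs. r \<le> real (card (cut_heavy t m xs))}
      = measure_pmf.expectation (?R m) (\<lambda>xs. measure_pmf.prob (?R k) {ys. r \<le> real (card (cut_heavy t m (xs @ ys)))})"
    unfolding n by (rule prob_replicate_pmf_add[OF finite_set_srw_step])
  also have "\<dots> \<le> measure_pmf.expectation (?R m) (\<lambda>xs. indicator {xs. M \<le> card (heavy t 0 xs)} xs + ?e)"
  proof (intro expectation_mono_finite finite_set_replicate_pmf finite_set_srw_step)
    fix xs assume "xs \<in> set_pmf (?R m)"
    then have xs: "length xs = m" by (simp add: set_replicate_pmf)
    show "measure_pmf.prob (?R k) {ys. r \<le> real (card (cut_heavy t m (xs @ ys)))}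
        \<le> indicator {xs. M \<le> card (heavy t 0 xs)} xs + ?e"
    proof (cases "M \<le> card (heavy t 0 xs)")
      case True
      have "measure_pmf.prob (?R k) {ys. r \<le> real (card (cut_heavy t m (xs @ ys)))} \<le> 1" by simp
      then show ?thesis using True by (simp add: add_increasing2)
    next
      case False
      have "t * r \<le> real (hits (heavy t 0 xs) (sum_list xs) ys)"
        if "r \<le> real (card (cut_heavy t m (xs @ ys)))" for ys
      proof -
        have "t * r \<le> t * real (card (cut_heavy t m (xs @ ys)))" using t that by simp
        also have "\<dots> \<le> real (hits (cut_heavy t m (xs @ ys)) (sum_list xs) ys)"
          by (rule hits_heavy_ge[OF t]) (use xs in \<open>simp add: cut_heavy_def\<close>)
        also have "\<dots> \<le> real (hits (heavy t 0 xs) (sum_list xs) ys)"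
          using xs by (intro of_nat_mono hits_mono) (simp add: cut_heavy_def)
        finally show ?thesis .
      qed
      then have "measure_pmf.prob (?R k) {ys. r \<le> real (card (cut_heavy t m (xs @ ys)))}
         \<le> measure_pmf.prob (?R k) {ys. t * r \<le> real (hits (heavy t 0 xs) (sum_list xs) ys)}"
        by (intro measure_pmf.finite_measure_mono) auto
      also have "\<dots> \<le> ?e"
        using False M by (intro visits_tail d finite_heavy t) auto
      finally show ?thesis by (simp add: add_increasing)
    qed
  qed
  also have "\<dots> = heavy_tail TYPE('d) m t M + ?e"
    by (subst Bochner_Integration.integral_add)
      (auto simp: heavy_tail_def intro!: integrable_measure_pmf_finite finite_set_replicate_pmf finite_set_srw_step)
  also have "\<dots> \<le> heavy_tail TYPE('d) n t M + ?e"
    using heavy_tail_mono_time[OF t m] by simp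
  finally show ?thesis .
qed

section \<open>Induction over time scales\<close>

text \<open>If there are \<open>s\<close> heavy sites, the blocks carry \<open>s / 2\<close> of them
  in total or one of the \<open>Q + 1\<close> cuts carries \<open>s / (2 * (Q + 1))\<close>. The
  blocks are left to \<open>block_sum_tail\<close>, the cuts to \<open>cut_heavy_tail\<close> with
  \<open>M = s * Q\<close>; \<open>many\<close> bounds the chance that the path before a cut has
  that many heavy sites.\<close>

lemma heavy_tail_split:
  assumes d: "CARD('d::finite) \<ge> 4" and t: "t > 0" and Q: "Q \<ge> 1" and s: "s \<ge> 1" and a: "a \<ge> 0"
    and q: "q = 1 - 2 / real CARD('d)"
    and blocks: "\<And>r. r \<ge> 1 \<Longrightarrow> heavy_tail TYPE('d) K (t / 2) r \<le> exp (- (a * real r powr q))"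
    and small: "real Q * real s * exp (- (a / 2)) \<le> 1"
    and many: "heavy_tail TYPE('d) (Q * K) (t / 4) (s * Q) \<le> exp (- (a * real s powr q))"
  shows "heavy_tail TYPE('d) (Q * K) t s \<le> exp (1 - a * real s powr q / 4) +
    (real Q + 1) * (exp (- (a * real s powr q)) +
      2 * exp (- (t * real s powr q / (64 * green_const CARD('d) * (real Q)\<^sup>2))))"
proof -
  let ?R = "replicate_pmf (Q * K) (srw_step :: (int ^ 'd) pmf)"
  let ?C = "green_const CARD('d)"
  define N where "N b = card (heavy (t / 2) 0 b)" for b :: "(int ^ 'd) list"
  define A where "A = {xs :: (int ^ 'd) list. real s / 2 \<le> (\<Sum>i<Q. real (N (take K (drop (i * K) xs))))}"
  define B where "B j = {xs :: (int ^ 'd) list. real s / (2 * (real Q + 1)) \<le> real (card (cut_heavy (t / 4) (j * K) xs))}" for j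
  have C: "?C \<ge> 1" by (rule green_const_ge_1)
  have q01: "0 \<le> q" "q \<le> 1" using d unfolding q by (auto simp: field_simps)
  have sub: "xs \<in> A \<union> (\<Union>j\<le>Q. B j)"
    if xs: "xs \<in> set_pmf ?R" and le: "s \<le> card (heavy t 0 xs)" for xs
  proof (rule ccontr)
    assume n: "xs \<notin> A \<union> (\<Union>j\<le>Q. B j)"
    have len: "length xs = Q * K" using xs by (simp add: set_replicate_pmf)
    have fin: "finite (heavy (t / 2) x b)" "finite (cut_heavy (t / 4) m xs)" for x and b :: "(int ^ 'd) list" and m
      using t by (auto simp: cut_heavy_def finite_heavy)
    have "card (heavy t 0 xs) \<le> card ((\<Union>i<Q. heavy (t / 2) (sum_list (take (i * K) xs)) (take K (drop (i * K) xs))) \<union>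
        (\<Union>j\<le>Q. cut_heavy (t / 4) (j * K) xs))"
      by (intro card_mono heavy_subset_blocks_cuts t len) (auto intro: fin)
    also have "\<dots> \<le> (\<Sum>i<Q. N (take K (drop (i * K) xs))) + (\<Sum>j\<le>Q. card (cut_heavy (t / 4) (j * K) xs))"
    proof (intro order_trans[OF card_Un_le] add_mono card_UN_le finite_atMost)
      have "card (\<Union>i<Q. heavy (t / 2) (sum_list (take (i * K) xs)) (take K (drop (i * K) xs)))
          \<le> (\<Sum>i<Q. card (heavy (t / 2) (sum_list (take (i * K) xs)) (take K (drop (i * K) xs))))"
        by (rule card_UN_le) simp
      then show "card (\<Union>i<Q. heavy (t / 2) (sum_list (take (i * K) xs)) (take K (drop (i * K) xs)))
          \<le> (\<Sum>i<Q. N (take K (drop (i * K) xs)))"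
        by (simp add: N_def card_heavy_translate[of _ "sum_list _"])
    qed
    finally have "real s \<le> (\<Sum>i<Q. real (N (take K (drop (i * K) xs)))) + (\<Sum>j\<le>Q. real (card (cut_heavy (t / 4) (j * K) xs)))"
      using le by (simp flip: of_nat_sum of_nat_add)
    moreover have "(\<Sum>i<Q. real (N (take K (drop (i * K) xs)))) < real s / 2"
      using n by (simp add: A_def not_le)
    moreover have "(\<Sum>j\<le>Q. real (card (cut_heavy (t / 4) (j * K) xs))) \<le> (\<Sum>j\<le>Q. real s / (2 * (real Q + 1)))"
      using n by (intro sum_mono) (auto simp: B_def not_le intro: less_imp_le)
    moreover have "(\<Sum>j\<le>Q. real s / (2 * (real Q + 1))) = real s / 2"
      by (simp add: field_simps)
    ultimately show False by linarith
  qed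
  have "heavy_tail TYPE('d) (Q * K) t s \<le> measure_pmf.prob ?R (A \<union> (\<Union>j\<le>Q. B j))"
    unfolding heavy_tail_def using sub
    by (intro measure_pmf.finite_measure_mono_AE) (auto simp: AE_measure_pmf_iff)
  also have "\<dots> \<le> measure_pmf.prob ?R A + measure_pmf.prob ?R (\<Union>j\<le>Q. B j)"
    by (intro measure_Un_le) auto
  also have "measure_pmf.prob ?R (\<Union>j\<le>Q. B j) \<le> (\<Sum>j\<le>Q. measure_pmf.prob ?R (B j))"
    by (intro measure_UNION_le) auto
  also have "measure_pmf.prob ?R A \<le> exp (1 - a * real s powr q / 4)"
    unfolding A_def
  proof (rule block_sum_tail[OF finite_set_srw_step s a q01 _ small])
    fix r :: nat assume "r \<ge> 1"
    then show "measure_pmf.prob (replicate_pmf K srw_step) {xs. r \<le> N xs} \<le> exp (- (a * real r powr q))"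
      using blocks[of r] by (simp add: heavy_tail_def N_def)
  qed
  also have "(\<Sum>j\<le>Q. measure_pmf.prob ?R (B j)) \<le> (\<Sum>j\<le>Q. exp (- (a * real s powr q)) +
      2 * exp (- (t * real s powr q / (64 * ?C * (real Q)\<^sup>2))))"
  proof (intro sum_mono)
    fix j assume "j \<in> {..Q}"
    then have "measure_pmf.prob ?R (B j) \<le> heavy_tail TYPE('d) (Q * K) (t / 4) (s * Q) +
       2 * exp (- (t / 4 * (real s / (2 * (real Q + 1))) / (4 * (?C * real (s * Q) powr (2 / real CARD('d))))))"
      unfolding B_def using s Q t by (intro cut_heavy_tail d) auto
    also have "\<dots> \<le> exp (- (a * real s powr q)) + 2 * exp (- (t * real s powr q / (64 * ?C * (real Q)\<^sup>2)))"
    proof (intro add_mono many mult_left_mono)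
      let ?w = "real s powr (2 / real CARD('d))"
      have w: "?w > 0" using s by simp
      have s_eq: "real s = real s powr q * ?w" using s by (simp add: q flip: powr_add)
      have "real Q powr (2 / real CARD('d)) \<le> real Q powr 1"
        using Q d by (intro powr_mono) auto
      then have Qle: "real Q powr (2 / real CARD('d)) \<le> real Q" using Q by simp
      \<comment> \<open>The level \<open>t / 4\<close>, the share \<open>s / (2 * (Q + 1))\<close>
        and the \<open>4\<close> of Khas'minskii's lemma give the \<open>32\<close>; then
        \<open>Q + 1 \<le> 2 * Q\<close> and \<open>Q powr (2 / d) \<le> Q\<close> produce
        \<open>64\<close> and the square of \<open>Q\<close>.\<close>
      have "t * real s powr q / (64 * ?C * (real Q)\<^sup>2) = t * real s / (64 * ?C * (real Q)\<^sup>2 * ?w)"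
        using w by (subst s_eq) simp
      also have "\<dots> \<le> t * real s / (32 * (real Q + 1) * ?C * (real Q powr (2 / real CARD('d)) * ?w))"
      proof (intro divide_left_mono)
        have "32 * (real Q + 1) * ?C * (real Q powr (2 / real CARD('d)) * ?w) \<le> 32 * (2 * real Q) * ?C * (real Q * ?w)"
          using Q C w Qle by (intro mult_mono) auto
        then show "32 * (real Q + 1) * ?C * (real Q powr (2 / real CARD('d)) * ?w) \<le> 64 * ?C * (real Q)\<^sup>2 * ?w"
          by (simp add: power2_eq_square algebra_simps)
      qed (use t Q C s w in auto)
      also have "\<dots> = t / 4 * (real s / (2 * (real Q + 1))) / (4 * (?C * real (s * Q) powr (2 / real CARD('d))))"
        by (simp add: powr_mult field_simps)
      finally show "exp (- (t / 4 * (real s / (2 * (real Q + 1))) / (4 * (?C * real (s * Q) powr (2 / real CARD('d))))))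
        \<le> exp (- (t * real s powr q / (64 * ?C * (real Q)\<^sup>2)))" by simp
    qed simp
    finally show "measure_pmf.prob ?R (B j) \<le> exp (- (a * real s powr q)) +
      2 * exp (- (t * real s powr q / (64 * ?C * (real Q)\<^sup>2)))" .
  qed
  finally show ?thesis by (simp add: add.commute)
qed

section \<open>Number of blocks and rate as functions of the time\<close>

lemma powr_le_exp_powr_eventually:
  fixes D e c \<beta> :: real
  assumes "c > 0" "\<beta> > 0"
  shows "\<forall>\<^sub>F n in sequentially. D * real n powr e \<le> exp (c * real n powr \<beta>)"
  using assms by real_asymp

text \<open>The number \<open>Q\<close> of blocks. The time scales are its powers, while the level
  stays a multiple of \<open>real n powr b\<close>.\<close>

definition cuts :: "real \<Rightarrow> nat \<Rightarrow> nat" where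
  "cuts \<epsilon> n = nat \<lceil>real n powr \<epsilon>\<rceil>"

lemma cuts_bounds:
  assumes "n \<ge> 1" "\<epsilon> > 0"
  shows "real n powr \<epsilon> \<le> real (cuts \<epsilon> n)" "real (cuts \<epsilon> n) \<le> 2 * real n powr \<epsilon>" "cuts \<epsilon> n \<ge> 1"
proof -
  have "real n powr \<epsilon> \<ge> 1" using assms by (intro ge_one_powr_ge_zero) auto
  then show "real n powr \<epsilon> \<le> real (cuts \<epsilon> n)" "real (cuts \<epsilon> n) \<le> 2 * real n powr \<epsilon>" "cuts \<epsilon> n \<ge> 1"
    unfolding cuts_def by linarith+
qed

lemma cuts_ge_3_eventually:
  assumes "\<epsilon> > 0"
  shows "\<forall>\<^sub>F n in sequentially. cuts \<epsilon> n \<ge> 3"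
proof -
  have "\<forall>\<^sub>F n in sequentially. real n powr \<epsilon> \<ge> 3" using assms by real_asymp
  with eventually_ge_at_top[of 1] show ?thesis
  proof eventually_elim
    case (elim n)
    then show ?case using cuts_bounds(1)[of n \<epsilon>] assms by linarith
  qed
qed

text \<open>The factor of \<open>real s powr q\<close> in the exponent that survives
  \<open>heavy_tail_split\<close>, up to a constant: the level divided by the square of
  \<open>Q\<close> lost at the cuts.\<close>

definition rate :: "real \<Rightarrow> real \<Rightarrow> nat \<Rightarrow> real" where
  "rate \<epsilon> b n = real n powr b / (real (cuts \<epsilon> n))\<^sup>2"

lemma rate_ge:
  assumes "n \<ge> 1" "\<epsilon> > 0"
  shows "real n powr (b - 2 * \<epsilon>) / 4 \<le> rate \<epsilon> b n"
proof -
  note c = cuts_bounds[OF assms]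
  have "real n powr (b - 2 * \<epsilon>) / 4 = real n powr b / (2 * real n powr \<epsilon>)\<^sup>2"
    using assms by (simp add: powr_diff power_mult_distrib powr_power mult.commute)
  also have "\<dots> \<le> rate \<epsilon> b n"
    unfolding rate_def using c assms by (intro divide_left_mono power_mono mult_pos_pos zero_less_power) auto
  finally show ?thesis .
qed

text \<open>As \<open>2 * \<epsilon> < b\<close>, the rate dominates a positive power of
  \<open>n\<close>, so prefactors polynomial in \<open>Q\<close> disappear in the
  exponential.\<close>

lemma cuts_power_le_exp_rate_eventually:
  assumes \<epsilon>: "\<epsilon> > 0" "2 * \<epsilon> < b" and c: "c > 0"
  shows "\<forall>\<^sub>F n in sequentially. 8 * real (cuts \<epsilon> n) ^ j \<le> exp (c * rate \<epsilon> b n)"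
proof -
  have "\<forall>\<^sub>F n in sequentially. 8 * 2 ^ j * real n powr (\<epsilon> * real j) \<le> exp (c / 4 * real n powr (b - 2 * \<epsilon>))"
    using \<epsilon> c by (intro powr_le_exp_powr_eventually) auto
  with eventually_ge_at_top[of 1] show ?thesis
  proof eventually_elim
    case (elim n)
    have "8 * real (cuts \<epsilon> n) ^ j \<le> 8 * (2 * real n powr \<epsilon>) ^ j"
      using cuts_bounds[OF elim(1) \<epsilon>(1)] by (intro mult_left_mono power_mono) auto
    also have "\<dots> = 8 * 2 ^ j * real n powr (\<epsilon> * real j)"
      using elim by (simp add: power_mult_distrib powr_power mult.commute)
    also have "\<dots> \<le> exp (c / 4 * real n powr (b - 2 * \<epsilon>))" by (rule elim)
    also have "\<dots> \<le> exp (c * rate \<epsilon> b n)"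
      using mult_left_mono[OF rate_ge[OF elim(1) \<epsilon>(1), of b], of c] c by simp
    finally show ?case .
  qed
qed

text \<open>The induction over decreasing set sizes on one time scale. Each \<open>i\<close> lowers
  the admissible \<open>s\<close> by a factor \<open>Q\<close>: in \<open>heavy_tail_split\<close>,
  \<open>many\<close> is the previous \<open>i\<close> at size \<open>s * Q\<close> and level
  \<open>c / 4\<close>, and the blocks are the previous time scale at level \<open>c / 2\<close>.
  Hence \<open>c\<close> is arbitrary in both inductions.\<close>

lemma heavy_tail_scales_step:
  assumes d: "CARD('d::finite) \<ge> 4" and q: "q = 1 - 2 / real CARD('d)"
    and \<epsilon>: "\<epsilon> > 0" "2 * \<epsilon> < b"
    and IH: "\<And>c. c > 0 \<Longrightarrow> \<exists>a>0. \<forall>\<^sub>F n in sequentially. \<forall>s\<ge>1.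
      heavy_tail TYPE('d) (cuts \<epsilon> n ^ k) (c * real n powr b) s \<le> exp (- (a * rate \<epsilon> b n * real s powr q))"
    and c: "c > 0"
  shows "\<exists>a>0. \<forall>\<^sub>F n in sequentially. \<forall>s\<ge>1. s * cuts \<epsilon> n ^ i > cuts \<epsilon> n ^ Suc k + 1 \<longrightarrow>
      heavy_tail TYPE('d) (cuts \<epsilon> n ^ Suc k) (c * real n powr b) s \<le> exp (- (a * rate \<epsilon> b n * real s powr q))"
  using c
proof (induction i arbitrary: c)
  case 0
  have "\<forall>\<^sub>F n in sequentially. \<forall>s\<ge>1. s * cuts \<epsilon> n ^ 0 > cuts \<epsilon> n ^ Suc k + 1 \<longrightarrow>
      heavy_tail TYPE('d) (cuts \<epsilon> n ^ Suc k) (c * real n powr b) s \<le> exp (- (1 * rate \<epsilon> b n * real s powr q))"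
    using eventually_ge_at_top[of 1]
    by eventually_elim (use 0 in \<open>auto simp: heavy_tail_eq_0_many_sites\<close>)
  then show ?case by (intro exI[of _ 1]) simp
next
  case (Suc i)
  let ?C = "green_const CARD('d)"
  have C: "?C \<ge> 1" by (rule green_const_ge_1)
  have c: "c > 0" by fact
  obtain a1 where a1: "a1 > 0" and ev1: "\<forall>\<^sub>F n in sequentially. \<forall>s\<ge>1.
      heavy_tail TYPE('d) (cuts \<epsilon> n ^ k) (c / 2 * real n powr b) s \<le> exp (- (a1 * rate \<epsilon> b n * real s powr q))"
    using IH[of "c / 2"] c by auto
  obtain a2 where a2: "a2 > 0" and ev2: "\<forall>\<^sub>F n in sequentially. \<forall>s\<ge>1. s * cuts \<epsilon> n ^ i > cuts \<epsilon> n ^ Suc k + 1 \<longrightarrow>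
      heavy_tail TYPE('d) (cuts \<epsilon> n ^ Suc k) (c / 4 * real n powr b) s \<le> exp (- (a2 * rate \<epsilon> b n * real s powr q))"
    using Suc.IH[of "c / 4"] c by auto
  define a0 where "a0 = min a1 a2"
  \<comment> \<open>With this \<open>a\<close> all exponentials from \<open>heavy_tail_split\<close>
    decay at rate at least \<open>2 * a\<close>; half of that is then spent on the prefactor of
    order \<open>Q\<close>.\<close>
  define a where "a = min (a0 / 8) (c / (128 * ?C))"
  have a0: "a0 > 0" "a0 \<le> a1" "a0 \<le> a2" "a0 / 2 > 0" using a1 a2 by (auto simp: a0_def)
  have a: "a > 0" "8 * a \<le> a0" "2 * a \<le> c / (64 * ?C)" using a0 c C by (auto simp: a_def min_def)
  have "\<forall>\<^sub>F n in sequentially. \<forall>s\<ge>1. s * cuts \<epsilon> n ^ Suc i > cuts \<epsilon> n ^ Suc k + 1 \<longrightarrow>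
      heavy_tail TYPE('d) (cuts \<epsilon> n ^ Suc k) (c * real n powr b) s \<le> exp (- (a * rate \<epsilon> b n * real s powr q))"
    using eventually_ge_at_top[of 1] cuts_ge_3_eventually[OF \<epsilon>(1)]
      cuts_power_le_exp_rate_eventually[OF \<epsilon> a0(4), of "k + 2"]
      cuts_power_le_exp_rate_eventually[OF \<epsilon> a(1), of 1] ev1 ev2
  proof eventually_elim
    case (elim n)
    define Q where "Q = cuts \<epsilon> n"
    define \<theta> where "\<theta> = rate \<epsilon> b n"
    define t where "t = c * real n powr b"
    have Q: "Q \<ge> 3" using elim by (simp add: Q_def)
    have t: "t > 0" using c elim by (simp add: t_def)
    have \<theta>: "\<theta> > 0" using elim Q unfolding \<theta>_def rate_def Q_def by simp
    have t\<theta>: "t / (real Q)\<^sup>2 = c * \<theta>" by (simp add: t_def \<theta>_def rate_def Q_def)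
    have q0: "q \<ge> 0" using d unfolding q by (auto simp: field_simps)
    show ?case
    proof (intro allI impI)
      fix s :: nat assume s: "s \<ge> 1" and big: "s * cuts \<epsilon> n ^ Suc i > cuts \<epsilon> n ^ Suc k + 1"
      \<comment> \<open>Either there are more sites than times, or \<open>s\<close> is bounded by a
        power of \<open>Q\<close>, which yields the condition \<open>small\<close>.\<close>
      show "heavy_tail TYPE('d) (cuts \<epsilon> n ^ Suc k) (c * real n powr b) s \<le> exp (- (a * rate \<epsilon> b n * real s powr q))"
      proof (cases "s > Q ^ Suc k + 1")
        case True
        then show ?thesis using t by (simp add: heavy_tail_eq_0_many_sites Q_def t_def)
      next
        case False
        define X where "X = \<theta> * real s powr q"
        have sq: "real s powr q \<ge> 1" using s q0 by (intro ge_one_powr_ge_zero) auto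
        have X: "X \<ge> \<theta>" "X > 0" using mult_left_mono[OF sq, of \<theta>] \<theta> s by (auto simp: X_def)
        have up: "heavy_tail TYPE('d) (Q * Q ^ k) (t / 4) (s * Q) \<le> exp (- (a0 * \<theta> * real s powr q))"
        proof -
          have "heavy_tail TYPE('d) (Q * Q ^ k) (t / 4) (s * Q) \<le> exp (- (a2 * \<theta> * real (s * Q) powr q))"
            using elim(6)[rule_format, of "s * Q"] s Q big by (simp add: Q_def t_def \<theta>_def mult.assoc)
          also have "\<dots> \<le> exp (- (a0 * \<theta> * real s powr q))"
            using a0 \<theta> q0 s Q by (auto intro!: mult_mono powr_mono2)
          finally show ?thesis .
        qed
        have small: "real Q * real s * exp (- (a0 * \<theta> / 2)) \<le> 1"
        proof -
          have "Q ^ Suc k \<ge> 1" using Q by simp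
          then have "s \<le> 2 * Q ^ Suc k" using False by linarith
          then have "real s \<le> real (2 * Q ^ Suc k)" by (rule of_nat_mono)
          then have "real Q * real s \<le> real Q * (2 * real Q ^ Suc k)" by (intro mult_left_mono) auto
          also have "\<dots> \<le> 8 * real Q ^ (k + 2)" by simp
          also have "\<dots> \<le> exp (a0 * \<theta> / 2)" using elim(3) a0 by (simp add: Q_def \<theta>_def)
          finally show ?thesis by (simp add: exp_minus field_simps)
        qed
        have "heavy_tail TYPE('d) (Q * Q ^ k) t s \<le> exp (1 - a0 * \<theta> * real s powr q / 4) +
          (real Q + 1) * (exp (- (a0 * \<theta> * real s powr q)) +
          2 * exp (- (t * real s powr q / (64 * ?C * (real Q)\<^sup>2))))"
        proof (rule heavy_tail_split[OF d t _ s _ q _ small up])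
          fix r :: nat assume r: "r \<ge> 1"
          have "heavy_tail TYPE('d) (Q ^ k) (t / 2) r \<le> exp (- (a1 * \<theta> * real r powr q))"
            using elim(5) r by (simp add: Q_def t_def \<theta>_def)
          also have "\<dots> \<le> exp (- (a0 * \<theta> * real r powr q))"
            using a0 \<theta> by (auto intro!: mult_right_mono)
          finally show "heavy_tail TYPE('d) (Q ^ k) (t / 2) r \<le> exp (- (a0 * \<theta> * real r powr q))" .
        qed (use Q a0 \<theta> in auto)
        also have "\<dots> \<le> exp 1 * exp (- (2 * a * X)) + (real Q + 1) * (exp (- (2 * a * X)) + 2 * exp (- (2 * a * X)))"
        proof (intro add_mono mult_left_mono)
          have "8 * a * X \<le> a0 * X" using a X by (intro mult_right_mono) auto
          then have l: "2 * a * X \<le> a0 * X / 4" "2 * a * X \<le> a0 * X"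
            using a X by (auto intro: order_trans[of _ "8 * a * X"] mult_right_mono)
          show "exp (1 - a0 * \<theta> * real s powr q / 4) \<le> exp 1 * exp (- (2 * a * X))"
            using l by (simp add: X_def mult.assoc flip: exp_add)
          show "exp (- (a0 * \<theta> * real s powr q)) \<le> exp (- (2 * a * X))"
            using l by (simp add: X_def mult.assoc)
          have "t * real s powr q / (64 * ?C * (real Q)\<^sup>2) = t / (real Q)\<^sup>2 * (real s powr q / (64 * ?C))"
            by (simp add: field_simps)
          also have "\<dots> = c / (64 * ?C) * X" unfolding t\<theta> X_def by simp
          also have "\<dots> \<ge> 2 * a * X" using a X by (intro mult_right_mono) auto
          finally show "exp (- (t * real s powr q / (64 * ?C * (real Q)\<^sup>2))) \<le> exp (- (2 * a * X))" by simp
        qed auto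
        also have "\<dots> = (exp 1 + 3 * (real Q + 1)) * exp (- (2 * a * X))" by (simp add: algebra_simps)
        also have "\<dots> \<le> exp (a * X) * exp (- (2 * a * X))"
        proof (intro mult_right_mono)
          have "exp 1 + 3 * (real Q + 1) \<le> 8 * real Q" using Q exp_le by simp
          also have "\<dots> \<le> exp (a * \<theta>)" using elim(4) by (simp add: Q_def \<theta>_def)
          also have "\<dots> \<le> exp (a * X)" using a X by simp
          finally show "exp 1 + 3 * (real Q + 1) \<le> exp (a * X)" .
        qed simp
        also have "\<dots> = exp (- (a * \<theta> * real s powr q))" by (simp add: X_def mult.assoc flip: exp_add)
        finally show ?thesis by (simp add: Q_def t_def \<theta>_def)
      qed
    qed
  qed
  then show ?case using a by blast
qed

text \<open>Induction over time scales. At \<open>k = 0\<close> there is a single step, hence at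
  most two visits, fewer than the level for large \<open>n\<close>. The constant \<open>a\<close>
  shrinks at each step, but \<open>k\<close> does not depend on \<open>n\<close>.\<close>

lemma heavy_tail_scales:
  assumes d: "CARD('d::finite) \<ge> 4" and q: "q = 1 - 2 / real CARD('d)"
    and \<epsilon>: "\<epsilon> > 0" "2 * \<epsilon> < b" and c: "c > 0"
  shows "\<exists>a>0. \<forall>\<^sub>F n in sequentially. \<forall>s\<ge>1.
      heavy_tail TYPE('d) (cuts \<epsilon> n ^ k) (c * real n powr b) s \<le> exp (- (a * rate \<epsilon> b n * real s powr q))"
  using c
proof (induction k arbitrary: c)
  case 0
  have "\<forall>\<^sub>F n in sequentially. c * real n powr b > 2" using 0 \<epsilon> by real_asymp
  then have "\<forall>\<^sub>F n in sequentially. \<forall>s\<ge>1.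
      heavy_tail TYPE('d) (cuts \<epsilon> n ^ 0) (c * real n powr b) s \<le> exp (- (1 * rate \<epsilon> b n * real s powr q))"
    by eventually_elim (auto simp: heavy_tail_eq_0_high_level)
  then show ?case by (intro exI[of _ 1]) simp
next
  case (Suc k)
  \<comment> \<open>For \<open>i = k + 2\<close> the size condition holds for every
    \<open>s \<ge> 1\<close> once \<open>Q \<ge> 3\<close>.\<close>
  obtain a where a: "a > 0" and ev: "\<forall>\<^sub>F n in sequentially. \<forall>s\<ge>1. s * cuts \<epsilon> n ^ (k + 2) > cuts \<epsilon> n ^ Suc k + 1 \<longrightarrow>
      heavy_tail TYPE('d) (cuts \<epsilon> n ^ Suc k) (c * real n powr b) s \<le> exp (- (a * rate \<epsilon> b n * real s powr q))"
    using heavy_tail_scales_step[OF d q \<epsilon> Suc.IH Suc.prems, of "k + 2"] by blast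
  from ev cuts_ge_3_eventually[OF \<epsilon>(1)]
  have "\<forall>\<^sub>F n in sequentially. \<forall>s\<ge>1.
      heavy_tail TYPE('d) (cuts \<epsilon> n ^ Suc k) (c * real n powr b) s \<le> exp (- (a * rate \<epsilon> b n * real s powr q))"
  proof eventually_elim
    case (elim n)
    let ?P = "cuts \<epsilon> n ^ Suc k"
    have "?P \<ge> 1" using elim by simp
    have "?P + 1 < s * cuts \<epsilon> n ^ (k + 2)" if "s \<ge> 1" for s
    proof -
      have "?P + 1 < 3 * ?P" using \<open>?P \<ge> 1\<close> by linarith
      also have "\<dots> \<le> cuts \<epsilon> n * ?P" using elim by (intro mult_right_mono) auto
      also have "\<dots> \<le> s * (cuts \<epsilon> n * ?P)" using that by simp
      finally show ?thesis by simp
    qed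
    then show ?case using elim by blast
  qed
  then show ?case using a by blast
qed

section \<open>Union bound and conclusion\<close>

lemma hits_pos_near:
  fixes x z :: "int ^ 'd::finite"
  assumes "set xs \<subseteq> unit_steps" "0 < hits {z} x xs"
  shows "\<bar>z $ i - x $ i\<bar> \<le> int (length xs)"
  using assms
proof (induction xs arbitrary: x)
  case Nil
  then show ?case by (simp split: if_splits)
next
  case (Cons s xs)
  have s: "\<bar>s $ i\<bar> \<le> 1" using Cons.prems(1) by (auto simp: unit_steps_def axis_def)
  show ?case
  proof (cases "x = z")
    case False
    then have "\<bar>z $ i - (x + s) $ i\<bar> \<le> int (length xs)"
      using Cons.IH[of "x + s"] Cons.prems by simp
    then show ?thesis using s by simp
  qed simp
qed

lemma
  fixes n :: nat
  shows finite_box: "finite {z :: int ^ 'd::finite. \<forall>i. \<bar>z $ i\<bar> \<le> int n}"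
    and card_box_le: "card {z :: int ^ 'd::finite. \<forall>i. \<bar>z $ i\<bar> \<le> int n} \<le> (2 * n + 1) ^ CARD('d)"
proof -
  let ?B = "{z :: int ^ 'd. \<forall>i. \<bar>z $ i\<bar> \<le> int n}"
  let ?P = "PiE (UNIV :: 'd set) (\<lambda>_. {- int n..int n})"
  have fin: "finite ?P" by (intro finite_PiE) auto
  have sub: "?B \<subseteq> (\<lambda>f. \<chi> i. f i) ` ?P"
  proof
    fix z :: "int ^ 'd" assume "z \<in> ?B"
    then have "- int n \<le> z $ i \<and> z $ i \<le> int n" for i by (simp add: abs_le_iff minus_le_iff)
    then have "(\<lambda>i. z $ i) \<in> ?P" by auto
    moreover have "z = (\<chi> i. z $ i)" by simp
    ultimately show "z \<in> (\<lambda>f. \<chi> i. f i) ` ?P" by blast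
  qed
  show "finite ?B" by (rule finite_subset[OF sub]) (use fin in simp)
  have "card ?B \<le> card ?P"
    by (rule order_trans[OF card_mono[OF _ sub] card_image_le]) (use fin in simp_all)
  also have "\<dots> = (2 * n + 1) ^ CARD('d)" by (simp add: card_PiE) (simp add: nat_add_distrib nat_mult_distrib)
  finally show "card ?B \<le> (2 * n + 1) ^ CARD('d)" .
qed

text \<open>All heavy sites lie in the box of radius \<open>n\<close>, so the prefactor bounds the
  number of sets of exactly \<open>N\<close> candidates. Each such set needs \<open>t * N\<close>
  visits.\<close>

lemma heavy_tail_union_bound:
  assumes d: "CARD('d::finite) \<ge> 4" and t: "t > 0" and N: "N \<ge> 1"
  shows "heavy_tail TYPE('d) n t N \<le> ((2 * real n + 1) ^ CARD('d)) ^ N *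
    (2 * exp (- (t * real N / (4 * (green_const CARD('d) * real N powr (2 / real CARD('d)))))))"
proof -
  let ?R = "replicate_pmf n (srw_step :: (int ^ 'd) pmf)"
  define B where "B = {z :: int ^ 'd. \<forall>i. \<bar>z $ i\<bar> \<le> int n}"
  define S where "S = {A. A \<subseteq> B \<and> card A = N}"
  define e where "e = 2 * exp (- (t * real N / (4 * (green_const CARD('d) * real N powr (2 / real CARD('d))))))"
  have finB: "finite B" unfolding B_def by (rule finite_box)
  have finS: "finite S" unfolding S_def using finB by simp
  have sub: "xs \<in> (\<Union>A\<in>S. {xs. t * real N \<le> real (hits A 0 xs)})"
    if xs: "xs \<in> set_pmf ?R" and le: "N \<le> card (heavy t 0 xs)" for xs
  proof -
    obtain A where A: "A \<subseteq> heavy t 0 xs" "card A = N"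
      using obtain_subset_with_card_n[OF le] by metis
    have "heavy t 0 xs \<subseteq> B"
    proof
      fix z assume "z \<in> heavy t 0 xs"
      then have "0 < hits {z} 0 xs" using t by (auto simp: heavy_def intro: Nat.gr0I)
      then show "z \<in> B"
        using hits_pos_near[of xs z 0] xs by (auto simp: B_def set_replicate_pmf set_srw_step in_lists_conv_set subset_eq)
    qed
    then have "A \<in> S" using A by (auto simp: S_def)
    moreover have "t * real N \<le> real (hits A 0 xs)" using hits_heavy_ge[OF t A(1)] A(2) by simp
    ultimately show ?thesis by auto
  qed
  have "heavy_tail TYPE('d) n t N \<le> measure_pmf.prob ?R (\<Union>A\<in>S. {xs. t * real N \<le> real (hits A 0 xs)})"
    unfolding heavy_tail_def using sub
    by (intro measure_pmf.finite_measure_mono_AE) (auto simp: AE_measure_pmf_iff)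
  also have "\<dots> \<le> (\<Sum>A\<in>S. measure_pmf.prob ?R {xs. t * real N \<le> real (hits A 0 xs)})"
    by (intro measure_UNION_le finS) auto
  also have "\<dots> \<le> (\<Sum>A\<in>S. e)"
    unfolding e_def using finB N
    by (intro sum_mono visits_tail d) (auto simp: S_def intro: finite_subset)
  also have "\<dots> = real (card S) * e" by simp
  also have "\<dots> \<le> ((2 * real n + 1) ^ CARD('d)) ^ N * e"
  proof (intro mult_right_mono)
    have "card S = card B choose N" unfolding S_def by (rule n_subsets[OF finB])
    also have "\<dots> \<le> card B ^ N"
      by (cases "N \<le> card B") (auto simp: binomial_le_pow binomial_eq_0)
    also have "\<dots> \<le> ((2 * n + 1) ^ CARD('d)) ^ N"
      unfolding B_def by (intro power_mono card_box_le) auto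
    finally have "real (card S) \<le> real (((2 * n + 1) ^ CARD('d)) ^ N)" by (rule of_nat_mono)
    then show "real (card S) \<le> ((2 * real n + 1) ^ CARD('d)) ^ N"
      by (simp add: add.commute)
  qed (simp add: e_def)
  finally show ?thesis by (simp add: e_def)
qed

text \<open>With \<open>h = 2 / CARD('d)\<close>, the union bound has an exponent of order
  \<open>real n powr b * real N powr (1 - h)\<close> against an entropy of order
  \<open>N * ln n\<close>. As \<open>N\<close> is of order \<open>real n powr \<gamma>\<close>, the
  exponent wins if \<open>h * \<gamma> < b\<close>.\<close>

lemma level_prob_large_b:
  fixes b \<gamma> y :: real
  assumes d: "CARD('d::finite) \<ge> 4" and pos: "b > 0" "\<gamma> > 0" "y > 0"
    and large: "b > 2 / real CARD('d) * \<gamma>"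
  shows "\<forall>\<^sub>F n in sequentially. level_prob TYPE('d) n b b' (real n powr \<gamma> * y)
    \<le> exp (- (1 / (8 * green_const CARD('d)) * y powr (1 - 2 / real CARD('d))
        * real n powr ((1 - 2 / real CARD('d)) * \<gamma> + b)))"
proof -
  define C where "C = green_const CARD('d)"
  define h where "h = 2 / real CARD('d)"
  have C: "C \<ge> 1" unfolding C_def by (rule green_const_ge_1)
  have h: "h > 0" "h \<le> 1" using d by (auto simp: h_def)
  have "h * \<gamma> < b" using large by (simp add: h_def)
  \<comment> \<open>The summand \<open>1\<close> next to the logarithm absorbs the factor
    \<open>2\<close> of the tail bound, and \<open>2 * y\<close> stems from
    \<open>real N \<le> 2 * X\<close>.\<close>
  then have ev: "\<forall>\<^sub>F n in sequentially. (8 * C * (2 * y) powr h) * (real CARD('d) * ln (2 * real n + 1) + 1) * real n powr (h * \<gamma>) \<le> real n powr b"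
    using pos by real_asymp
  have "\<forall>\<^sub>F n in sequentially. real n powr \<gamma> * y \<ge> 1" using pos by real_asymp
  with ev eventually_ge_at_top[of 1] show ?thesis
  proof eventually_elim
    case (elim n)
    define X where "X = real n powr \<gamma> * y"
    define N where "N = nat \<lfloor>X\<rfloor> + 1"
    define L where "L = real CARD('d) * ln (2 * real n + 1) + 1"
    have X: "X \<ge> 1" using elim by (simp add: X_def)
    have N: "N \<ge> 1" "X \<le> real N" "real N \<le> 2 * X" using X unfolding N_def by linarith+
    have L: "L \<ge> 0" using elim by (simp add: L_def)
    have "level_prob TYPE('d) n b b' X \<le> heavy_tail TYPE('d) n (real n powr b) N"
      unfolding N_def using elim X by (intro level_prob_le_heavy_tail) auto
    also have "\<dots> \<le> ((2 * real n + 1) ^ CARD('d)) ^ N *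
       (2 * exp (- (real n powr b * real N / (4 * (C * real N powr h)))))"
      unfolding C_def h_def using elim N by (intro heavy_tail_union_bound d) auto
    also have "(2 * real n + 1) ^ CARD('d) = exp (real CARD('d) * ln (2 * real n + 1))"
      by (subst exp_of_nat_mult) (simp add: add_pos_nonneg)
    also have "exp (real CARD('d) * ln (2 * real n + 1)) ^ N * (2 * exp (- (real n powr b * real N / (4 * (C * real N powr h)))))
       \<le> exp (real CARD('d) * ln (2 * real n + 1)) ^ N * (exp 1 ^ N * exp (- (real n powr b * real N / (4 * (C * real N powr h)))))"
    proof (intro mult_left_mono mult_right_mono)
      have "2 \<le> exp (1::real)" using exp_ge_add_one_self[of 1] by simp
      also have "\<dots> \<le> exp 1 ^ N" using N by (intro self_le_power) auto
      finally show "2 \<le> exp (1::real) ^ N" .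
    qed auto
    also have "\<dots> = exp (real N * L - real n powr b * real N / (4 * (C * real N powr h)))"
      by (simp add: L_def exp_diff exp_minus exp_add distrib_left field_simps flip: exp_of_nat_mult)
    also have "\<dots> \<le> exp (- (1 / (8 * C) * real n powr b * real N powr (1 - h)))"
    proof -
      have Nh: "real N powr h > 0" using N by simp
      have "8 * C * real N powr h * L \<le> 8 * C * ((2 * X) powr h) * L"
        using N C L h by (intro mult_right_mono mult_left_mono powr_mono2) auto
      also have "(2 * X) powr h = (2 * y) powr h * real n powr (h * \<gamma>)"
        using pos by (simp add: X_def powr_mult powr_powr mult.commute)
      also have "8 * C * ((2 * y) powr h * real n powr (h * \<gamma>)) * L \<le> real n powr b"
        using elim(1) by (simp add: L_def mult_ac)
      finally have "L \<le> real n powr b / (8 * C * real N powr h)"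
        using Nh C by (simp add: field_simps)
      \<comment> \<open>\<open>W\<close> is half of the exponent of the union bound; the entropy
        \<open>real N * L\<close> costs at most the other half.\<close>
      define W where "W = real N * (real n powr b / (8 * C * real N powr h))"
      have "real N * L \<le> W"
        unfolding W_def using \<open>L \<le> _\<close> by (intro mult_left_mono) auto
      moreover have "1 / (8 * C) * real n powr b * real N powr (1 - h) = W"
        using N by (simp add: W_def powr_diff)
      moreover have "real n powr b * real N / (4 * (C * real N powr h)) = 2 * W"
        by (simp add: W_def)
      ultimately show ?thesis by simp
    qed
    also have "\<dots> \<le> exp (- (1 / (8 * C) * real n powr b * X powr (1 - h)))"
      using N X h C by (auto intro!: divide_right_mono mult_left_mono powr_mono2)
    also have "1 / (8 * C) * real n powr b * X powr (1 - h) = 1 / (8 * C) * y powr (1 - h) * real n powr ((1 - h) * \<gamma> + b)"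
      using pos by (simp add: X_def powr_mult powr_powr powr_add mult_ac)
    finally show ?case by (simp add: X_def C_def h_def)
  qed
qed

text \<open>For sets of about \<open>real n powr \<gamma> * y\<close> sites,
  \<open>real s powr q\<close> contributes \<open>q * \<gamma>\<close> to the exponent of
  \<open>n\<close> and \<open>rate\<close> contributes \<open>b - 2 * \<epsilon>\<close>. The gap
  between \<open>\<zeta>\<close> and the sum absorbs all constants.\<close>

lemma level_prob_small_\<zeta>:
  fixes b \<gamma> \<delta> y \<zeta> :: real
  assumes d: "CARD('d::finite) \<ge> 4" and pos: "b > 0" "\<gamma> > 0" "\<delta> > 0" "y > 0"
    and \<zeta>: "\<zeta> < (1 - 2 / real CARD('d)) * \<gamma> + b - \<delta>"
  shows "\<forall>\<^sub>F n in sequentially. level_prob TYPE('d) n b b' (real n powr \<gamma> * y) \<le> exp (- (real n powr \<zeta>))"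
proof -
  define q where "q = 1 - 2 / real CARD('d)"
  \<comment> \<open>\<open>2 * \<epsilon> < \<delta>\<close> makes the loss in \<open>rate\<close>
    of smaller order than \<open>real n powr \<delta>\<close>, and \<open>2 * \<epsilon> < b\<close>
    lets \<open>rate\<close> grow.\<close>
  define \<epsilon> where "\<epsilon> = min \<delta> b / 4"
  have \<epsilon>: "\<epsilon> > 0" "2 * \<epsilon> < b" "2 * \<epsilon> < \<delta>" using pos by (auto simp: \<epsilon>_def min_def)
  have q0: "q \<ge> 0" using d by (auto simp: q_def field_simps)
  \<comment> \<open>With this \<open>k\<close> the time scale \<open>cuts \<epsilon> n ^ k\<close>
    is at least \<open>n\<close>.\<close>
  obtain k where k: "1 / \<epsilon> \<le> real k" using real_arch_simple by blast
  obtain a where a: "a > 0" and ev: "\<forall>\<^sub>F n in sequentially. \<forall>s\<ge>1.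
      heavy_tail TYPE('d) (cuts \<epsilon> n ^ k) (1 * real n powr b) s \<le> exp (- (a * rate \<epsilon> b n * real s powr q))"
    using heavy_tail_scales[OF d q_def \<epsilon>(1,2), of 1 k] by auto
  have "\<zeta> < b - 2 * \<epsilon> + q * \<gamma>" using \<zeta> \<epsilon> unfolding q_def by simp
  moreover have "a / 4 * y powr q > 0" using a pos by simp
  ultimately have "\<forall>\<^sub>F n in sequentially. real n powr \<zeta> \<le> a / 4 * y powr q * real n powr (b - 2 * \<epsilon> + q * \<gamma>)"
    by real_asymp
  with ev eventually_ge_at_top[of 1] show ?thesis
  proof eventually_elim
    case (elim n)
    define X where "X = real n powr \<gamma> * y"
    define N where "N = nat \<lfloor>X\<rfloor> + 1"
    have X: "X \<ge> 0" using pos by (simp add: X_def)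
    have N: "N \<ge> 1" "X \<le> real N" using X unfolding N_def by linarith+
    have "real n powr 1 \<le> real n powr (\<epsilon> * real k)"
      using elim k \<epsilon> by (intro powr_mono) (auto simp: field_simps)
    also have "\<dots> = (real n powr \<epsilon>) ^ k" using elim by (simp add: powr_power mult.commute)
    also have "\<dots> \<le> real (cuts \<epsilon> n) ^ k"
      using cuts_bounds[OF elim(2) \<epsilon>(1)] by (intro power_mono) auto
    finally have nk: "n \<le> cuts \<epsilon> n ^ k" using elim by (simp flip: of_nat_power)
    have "level_prob TYPE('d) n b b' X \<le> heavy_tail TYPE('d) n (real n powr b) N"
      unfolding N_def using elim X by (intro level_prob_le_heavy_tail) auto
    also have "\<dots> \<le> heavy_tail TYPE('d) (cuts \<epsilon> n ^ k) (real n powr b) N"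
      using elim by (intro heavy_tail_mono_time nk) auto
    also have "\<dots> \<le> exp (- (a * rate \<epsilon> b n * real N powr q))"
      using elim(1) N by simp
    also have "\<dots> \<le> exp (- (real n powr \<zeta>))"
    proof -
      have "real n powr \<zeta> \<le> a * (real n powr (b - 2 * \<epsilon>) / 4) * X powr q"
        using elim(3) pos by (simp add: X_def powr_mult powr_powr powr_add mult_ac)
      also have "\<dots> \<le> a * rate \<epsilon> b n * real N powr q"
        using a rate_ge[OF elim(2) \<epsilon>(1), of b] N X q0
        by (intro mult_mono mult_left_mono powr_mono2) (auto simp: rate_def)
      finally show ?thesis by simp
    qed
    finally show ?case by (simp add: X_def)
  qed
qed

text \<open>The endpoint rate is stated with its constant: \<open>\<kappa>\<close> is chosen before
  all other parameters and so depends on \<open>'d\<close> only, and the factor in \<open>y\<close>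
  is explicit.\<close>

theorem proposition1p7:
  assumes "CARD('d::finite) \<ge> 5"
  shows "\<exists>\<kappa>>0. \<forall>b>0. \<forall>\<gamma>>0. \<exists>\<delta>\<^sub>0>0. \<forall>\<delta>. 0 < \<delta> \<and> \<delta> < \<delta>\<^sub>0 \<longrightarrow> (\<forall>y>0.
    ((\<gamma> + 2 * b > 1
      \<or> \<gamma> + 2 * b = 1 \<and> ennreal y > 1 + (\<Sum>\<^sub>\<infinity>x::int ^ 'd. green x ^ 2)
      \<or> b > 2 / real CARD('d) * \<gamma>) \<longrightarrow>
     (\<forall>\<zeta>. 0 < \<zeta> \<and> \<zeta> < (1 - 2 / real CARD('d)) * \<gamma> + b - \<delta> \<longrightarrow>
        (\<forall>\<^sub>F n in sequentially.
           level_prob TYPE('d) n b (b + \<delta>) (real n powr \<gamma> * y) \<le> exp (- (real n powr \<zeta>))))) \<and>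
    (b > 2 / real CARD('d) * \<gamma> \<longrightarrow>
     (\<forall>\<^sub>F n in sequentially.
        level_prob TYPE('d) n b (b + \<delta>) (real n powr \<gamma> * y)
          \<le> exp (- (\<kappa> * y powr (1 - 2 / real CARD('d))
                    * real n powr ((1 - 2 / real CARD('d)) * \<gamma> + b))))))"
proof -
  have d: "CARD('d) \<ge> 4" using assms by simp
  show ?thesis
  \<comment> \<open>The constant is half of the Khas'minskii rate
    \<open>1 / (4 * green_const CARD('d))\<close>, the entropy taking the other half;
    \<open>\<delta>\<^sub>0\<close> is \<open>1\<close>.\<close>
  proof (rule exI[of _ "1 / (8 * green_const CARD('d))"], intro conjI allI impI exI[of _ "1::real"])
    show "0 < 1 / (8 * green_const CARD('d))" using green_const_ge_1[of "CARD('d)"] by simp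
  next
    fix b \<gamma> \<delta> y \<zeta> :: real
    assume "b > 0" "\<gamma> > 0" "0 < \<delta> \<and> \<delta> < 1" "y > 0"
      "0 < \<zeta> \<and> \<zeta> < (1 - 2 / real CARD('d)) * \<gamma> + b - \<delta>"
    then show "\<forall>\<^sub>F n in sequentially.
        level_prob TYPE('d) n b (b + \<delta>) (real n powr \<gamma> * y) \<le> exp (- (real n powr \<zeta>))"
      by (intro level_prob_small_\<zeta>[OF d, where \<delta> = \<delta>]) auto
  next
    fix b \<gamma> \<delta> y :: real
    assume "b > 0" "\<gamma> > 0" "y > 0" "b > 2 / real CARD('d) * \<gamma>"
    then show "\<forall>\<^sub>F n in sequentially. level_prob TYPE('d) n b (b + \<delta>) (real n powr \<gamma> * y)
        \<le> exp (- (1 / (8 * green_const CARD('d)) * y powr (1 - 2 / real CARD('d))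
          * real n powr ((1 - 2 / real CARD('d)) * \<gamma> + b)))"
      by (rule level_prob_large_b[OF d])
  qed auto
qed

end
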